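(* There exist a 1-generic set $G\in 2^\omega$ and a uniformly almost everywhere dominating function $f\in\omega^\omega$ such that $f\leq_T G$.
   Context: $2^{<\omega}$ is the set of finite binary strings, and $\sigma\sqsubseteq\tau$ means that $\sigma$ is an initial segment of $\tau$ (here $\tau$ may be a finite string or an infinite sequence). $\leq_T$ is Turing reducibility. A set $G\in 2^\omega$ is 1-generic if, for every r.e. (recursively enumerable) set $S\subseteq 2^{<\omega}$, either some initial segment of $G$ lies in $S$, or some initial segment $\rho\sqsubseteq G$ has no extension in $S$. For $f,g\in\omega^\omega$, $f$ dominates $g$, written $g\leq^* f$, if $(\exists n_0)(\forall n\geq n_0)\; g(n)\leq f(n)$. A function $f\in\omega^\omega$ is uniformly almost everywhere dominating if $$\mu\bigl(\{Z\in 2^\omega:(\forall g\in\omega^\omega)(g\leq_T Z\Rightarrow g\leq^* f)\}\bigr)=1,$$ where $\mu$ is the uniform (Lebesgue, fair-coin) measure on $2^\omega$. *)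

theory Defs
  imports "HOL-Probability.Probability" "HOL-Library.Sublist" "HOL-Library.Nat_Bijection"
begin

section \<open>Partial recursive functions relative to an oracle\<close>

text \<open>Kleene's schemes; \<open>Oracle\<close> adds the function given as oracle to the initial functions.\<close>

datatype recfun =
    Zero
  | Succ
  | Proj nat
  | Oracle
  | Comp recfun "recfun list"
  | PrimRec recfun recfun
  | Mu recfun

text \<open>\<open>evaluates A e xs y\<close> means that the partial function described by \<open>e\<close>, with oracle \<open>A\<close>,
  is defined at the tuple \<open>xs\<close> and has value \<open>y\<close> there. Arities are not part of a description:
  \<open>Zero\<close> and \<open>Proj i\<close> serve for every arity at which they make sense, and a description is
  undefined at tuples of unsuitable length.\<close>

inductive evaluates :: "(nat \<Rightarrow> nat) \<Rightarrow> recfun \<Rightarrow> nat list \<Rightarrow> nat \<Rightarrow> bool"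
  for A :: "nat \<Rightarrow> nat" where
  Zero: "evaluates A Zero xs 0"
| Succ: "evaluates A Succ [x] (Suc x)"
| Proj: "i < length xs \<Longrightarrow> evaluates A (Proj i) xs (xs ! i)"
| Oracle: "evaluates A Oracle [x] (A x)"
| Comp: "list_all2 (\<lambda>g y. evaluates A g xs y) gs ys \<Longrightarrow> evaluates A f ys z
    \<Longrightarrow> evaluates A (Comp f gs) xs z"
| PrimRec_0: "evaluates A f xs y \<Longrightarrow> evaluates A (PrimRec f g) (0 # xs) y"
| PrimRec_Suc: "evaluates A (PrimRec f g) (n # xs) r \<Longrightarrow> evaluates A g (n # r # xs) y
    \<Longrightarrow> evaluates A (PrimRec f g) (Suc n # xs) y"
| Mu: "evaluates A f (n # xs) 0 \<Longrightarrow> (\<forall>i<n. \<exists>v. v \<noteq> 0 \<and> evaluates A f (i # xs) v)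
    \<Longrightarrow> evaluates A (Mu f) xs n"

inductive_cases evaluates_elims:
  "evaluates A Zero xs y"
  "evaluates A Succ xs y"
  "evaluates A (Proj i) xs y"
  "evaluates A Oracle xs y"
  "evaluates A (Comp f gs) xs y"
  "evaluates A (PrimRec f g) (0 # xs) y"
  "evaluates A (PrimRec f g) (Suc n # xs) y"
  "evaluates A (Mu f) xs y"

lemma evaluates_deterministic:
  "evaluates A e xs y \<Longrightarrow> evaluates A e xs y' \<Longrightarrow> y = y'"
proof (induction arbitrary: y' rule: evaluates.induct)
  case (Comp xs gs ys f z)
  from Comp.prems obtain ys' where ys': "list_all2 (\<lambda>g y. evaluates A g xs y) gs ys'"
    and z: "evaluates A f ys' y'"
    by (blast elim: evaluates_elims)
  have "ys = ys'"
  proof (rule nth_equalityI)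
    show "length ys = length ys'"
      using Comp.IH(1) ys' by (simp add: list_all2_lengthD[symmetric])
    fix i assume "i < length ys"
    then show "ys ! i = ys' ! i"
      using Comp.IH(1) ys' by (auto simp: list_all2_conv_all_nth)
  qed
  with z show ?case using Comp.IH(2) by blast
next
  case (Mu f n xs)
  from Mu.prems have *: "evaluates A f (y' # xs) 0" "\<forall>i<y'. \<exists>v. v \<noteq> 0 \<and> evaluates A f (i # xs) v"
    by (rule evaluates_elims(8); blast)+
  show ?case
  proof (rule linorder_cases[of n y'])
    assume "n < y'" then show ?thesis using Mu.IH(1) *(2) by metis
  next
    assume "y' < n" then show ?thesis using Mu.IH(2) *(1) by metis
  qed
next
  case (PrimRec_Suc f g n xs r y)
  from PrimRec_Suc.prems obtain r' where "evaluates A (PrimRec f g) (n # xs) r'"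
    "evaluates A g (n # r' # xs) y'"
    by (blast elim: evaluates_elims)
  then show ?case using PrimRec_Suc.IH by blast
qed (blast elim: evaluates_elims)+

fun oracle_free :: "recfun \<Rightarrow> bool" where
  "oracle_free Zero \<longleftrightarrow> True"
| "oracle_free Succ \<longleftrightarrow> True"
| "oracle_free (Proj i) \<longleftrightarrow> True"
| "oracle_free Oracle \<longleftrightarrow> False"
| "oracle_free (Comp f gs) \<longleftrightarrow> oracle_free f \<and> (\<forall>g\<in>set gs. oracle_free g)"
| "oracle_free (PrimRec f g) \<longleftrightarrow> oracle_free f \<and> oracle_free g"
| "oracle_free (Mu f) \<longleftrightarrow> oracle_free f"


section \<open>Turing reducibility and recursively enumerable sets of strings\<close>

definition char_fun :: "(nat \<Rightarrow> bool) \<Rightarrow> nat \<Rightarrow> nat" where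
  "char_fun Z n = of_bool (Z n)"

definition turing_reducible :: "(nat \<Rightarrow> nat) \<Rightarrow> (nat \<Rightarrow> bool) \<Rightarrow> bool"  (infix \<open>\<le>\<^sub>T\<close> 50) where
  "f \<le>\<^sub>T Z \<longleftrightarrow> (\<exists>e. \<forall>n. evaluates (char_fun Z) e [n] (f n))"

definition string_code :: "bool list \<Rightarrow> nat" where
  "string_code \<sigma> = list_encode (map of_bool \<sigma>)"

text \<open>Domains of partial recursive functions. The oracle \<open>\<lambda>_. 0\<close> is a dummy, never consulted by
  an oracle-free description.\<close>

definition re_strings :: "bool list set \<Rightarrow> bool" where
  "re_strings S \<longleftrightarrow>
    (\<exists>e. oracle_free e \<and> (\<forall>\<sigma>. \<sigma> \<in> S \<longleftrightarrow> (\<exists>y. evaluates (\<lambda>_. 0) e [string_code \<sigma>] y)))"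


section \<open>Genericity and domination\<close>

definition initial_segment :: "bool list \<Rightarrow> (nat \<Rightarrow> bool) \<Rightarrow> bool" where
  "initial_segment \<sigma> Z \<longleftrightarrow> (\<forall>i<length \<sigma>. \<sigma> ! i = Z i)"

definition one_generic :: "(nat \<Rightarrow> bool) \<Rightarrow> bool" where
  "one_generic G \<longleftrightarrow> (\<forall>S. re_strings S \<longrightarrow>
     (\<exists>\<sigma>. initial_segment \<sigma> G \<and> \<sigma> \<in> S) \<or>
     (\<exists>\<rho>. initial_segment \<rho> G \<and> (\<forall>\<tau>. prefix \<rho> \<tau> \<longrightarrow> \<tau> \<notin> S)))"

definition dominated_by :: "(nat \<Rightarrow> nat) \<Rightarrow> (nat \<Rightarrow> nat) \<Rightarrow> bool"  (infix \<open>\<le>\<^sup>*\<close> 50) where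
  "g \<le>\<^sup>* f \<longleftrightarrow> (\<exists>n\<^sub>0. \<forall>n\<ge>n\<^sub>0. g n \<le> f n)"

definition fair_coin_measure :: "(nat \<Rightarrow> bool) measure" where
  "fair_coin_measure = Pi\<^sub>M UNIV (\<lambda>_. measure_pmf (bernoulli_pmf (1/2)))"

text \<open>\<open>emeasure\<close> is 0 on non-measurable sets, so the equation below includes measurability of the
  set with respect to the product (Borel) sigma-algebra.\<close>

definition uniformly_ae_dominating :: "(nat \<Rightarrow> nat) \<Rightarrow> bool" where
  "uniformly_ae_dominating f \<longleftrightarrow>
     emeasure fair_coin_measure {Z. \<forall>g. g \<le>\<^sub>T Z \<longrightarrow> g \<le>\<^sup>* f} = 1"

end

(*
  f is read off G by a fixed procedure. A 1 of G at an odd position h introduces a requirement: it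
  announces a functional e and a rational r, meaning mu (Tot e) > r, where Tot e is the class of oracles
  at which e is total. A 1 at an even position q proposes q as the next value f n. The proposal is
  accepted iff, for every active requirement, the class of the oracles at which e converges on
  0, ..., n within q steps (intersected with the classes from the earlier values) still has measure at
  least r minus a budget. Hence the class P that survives for ever lies in Tot e, f dominates every
  function computed by e from a member of P, and mu P is close to mu (Tot e).

  The point is that the check is computable, so G may be extended arbitrarily: whatever an extension
  does, the accepted values respect the active requirements. When G meets the l-th r.e. set of strings,
  the requirements of level at least l are cancelled and the budget of the others grows by 2^-l. So
  before looking for an extension in that set one first accepts values until the surviving class of
  every active requirement exceeds Tot e by less than 2^-l; afterwards the class still meets Tot e in
  measure larger than the (new) bound, and the construction can go on. A true requirement of level l is
  introduced once the l-th set has been met, or can no longer be met, and is never cancelled.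
*)

theory Submission imports Defs begin

section \<open>Computable functions and decidable predicates\<close>

text \<open>Totality is not decidable, so a procedure reading G cannot compare a surviving class
  with \<open>total e\<close>. Two inequalities are therefore kept apart. \<open>admissible\<close>
  bounds the measure of the whole surviving class from below and binds every continuation.
  \<open>fulfilled\<close> bounds the measure of its part inside \<open>total e\<close>; it is what
  keeps further values available, and an arbitrary continuation may destroy it. The constant 2^-l
  measures the gap: when less than 2^-l of the class lies outside \<open>total e\<close>, measure at
  least r - b for the class leaves more than r - b - 2^-l inside. A requirement of level j pays only
  for sets of index above j, so at most 2^-j in all, and since every true requirement recurs at
  arbitrarily high levels, the total loss can be made as small as desired. A continuation may also
  bring in false requirements, which could block all later values. Levels below l are protected
  against this, each being held by a requirement that stays active; this is why a filler is
  introduced when the scheduled requirement is false.\<close>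

definition computable_arity :: "(nat \<Rightarrow> nat) \<Rightarrow> nat \<Rightarrow> (nat list \<Rightarrow> nat) \<Rightarrow> bool" where
  "computable_arity A k F \<longleftrightarrow> (\<exists>e. \<forall>xs. length xs = k \<longrightarrow> evaluates A e xs (F xs))"

lemma computable_arityI:
  assumes "\<And>xs. length xs = k \<Longrightarrow> evaluates A e xs (F xs)"
  shows "computable_arity A k F"
  using assms unfolding computable_arity_def by blast

lemma computable_arity_cong:
  assumes "computable_arity A k F" "\<And>xs. length xs = k \<Longrightarrow> F xs = G xs"
  shows "computable_arity A k G"
  using assms unfolding computable_arity_def by metis

lemma computable_arity_zero: "computable_arity A k (\<lambda>_. 0)"
  by (rule computable_arityI[of _ _ Zero]) (rule evaluates.Zero)

lemma computable_arity_proj: "i < k \<Longrightarrow> computable_arity A k (\<lambda>xs. xs ! i)"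
  by (rule computable_arityI[of _ _ "Proj i"]) (auto intro: evaluates.Proj)

lemma computable_arity_comp1:
  assumes "computable_arity A 1 (\<lambda>xs. f (xs ! 0))" "computable_arity A k F"
  shows "computable_arity A k (\<lambda>xs. f (F xs))"
proof -
  obtain e where e: "\<And>xs. length xs = 1 \<Longrightarrow> evaluates A e xs (f (xs ! 0))"
    using assms(1) unfolding computable_arity_def by blast
  obtain d where d: "\<And>xs. length xs = k \<Longrightarrow> evaluates A d xs (F xs)"
    using assms(2) unfolding computable_arity_def by blast
  show ?thesis
  proof (rule computable_arityI[of _ _ "Comp e [d]"])
    fix xs :: "nat list" assume "length xs = k"
    then show "evaluates A (Comp e [d]) xs (f (F xs))"
      using e[of "[F xs]"] d by (auto intro!: evaluates.Comp[where ys="[F xs]"])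
  qed
qed

lemma computable_arity_comp2:
  assumes "computable_arity A 2 (\<lambda>xs. f (xs ! 0) (xs ! 1))"
    "computable_arity A k F" "computable_arity A k G"
  shows "computable_arity A k (\<lambda>xs. f (F xs) (G xs))"
proof -
  obtain e where e: "\<And>xs. length xs = 2 \<Longrightarrow> evaluates A e xs (f (xs ! 0) (xs ! 1))"
    using assms(1) unfolding computable_arity_def by blast
  obtain c where c: "\<And>xs. length xs = k \<Longrightarrow> evaluates A c xs (F xs)"
    using assms(2) unfolding computable_arity_def by blast
  obtain d where d: "\<And>xs. length xs = k \<Longrightarrow> evaluates A d xs (G xs)"
    using assms(3) unfolding computable_arity_def by blast
  show ?thesis
  proof (rule computable_arityI[of _ _ "Comp e [c, d]"])
    fix xs :: "nat list" assume "length xs = k"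
    then show "evaluates A (Comp e [c, d]) xs (f (F xs) (G xs))"
      using e[of "[F xs, G xs]"] c d by (auto intro!: evaluates.Comp[where ys="[F xs, G xs]"])
  qed
qed

lemma computable_arity_Suc:
  "computable_arity A k F \<Longrightarrow> computable_arity A k (\<lambda>xs. Suc (F xs))"
  by (rule computable_arity_comp1[where f=Suc], rule computable_arityI[of _ _ Succ])
    (auto simp: length_Suc_conv intro: evaluates.Succ)

lemma computable_arity_oracle:
  "computable_arity A k F \<Longrightarrow> computable_arity A k (\<lambda>xs. A (F xs))"
  by (rule computable_arity_comp1[where f=A], rule computable_arityI[of _ _ Oracle])
    (auto simp: length_Suc_conv intro: evaluates.Oracle)

lemma computable_arity_rec:
  assumes "computable_arity A k B" "computable_arity A (Suc (Suc k)) H"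
  shows "computable_arity A (Suc k)
    (\<lambda>xs. rec_nat (B (tl xs)) (\<lambda>n r. H (n # r # tl xs)) (hd xs))"
proof -
  obtain b where b: "\<And>xs. length xs = k \<Longrightarrow> evaluates A b xs (B xs)"
    using assms(1) unfolding computable_arity_def by blast
  obtain h where h: "\<And>xs. length xs = Suc (Suc k) \<Longrightarrow> evaluates A h xs (H xs)"
    using assms(2) unfolding computable_arity_def by blast
  have "evaluates A (PrimRec b h) (n # xs) (rec_nat (B xs) (\<lambda>n r. H (n # r # xs)) n)"
    if "length xs = k" for n xs
  proof (induction n)
    case 0 then show ?case using b that by (auto intro: evaluates.PrimRec_0)
  next
    case (Suc n) then show ?case using h that by (auto intro: evaluates.PrimRec_Suc)
  qed
  then show ?thesis
    by (intro computable_arityI[of _ _ "PrimRec b h"]) (auto simp: length_Suc_conv)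
qed

lemma computable_arity_Least:
  assumes "computable_arity A (Suc k) H" "\<And>xs. length xs = k \<Longrightarrow> \<exists>n. H (n # xs) = 0"
  shows "computable_arity A k (\<lambda>xs. LEAST n. H (n # xs) = 0)"
proof -
  obtain h where h: "\<And>xs. length xs = Suc k \<Longrightarrow> evaluates A h xs (H xs)"
    using assms(1) unfolding computable_arity_def by blast
  show ?thesis
  proof (rule computable_arityI[of _ _ "Mu h"])
    fix xs :: "nat list" assume len: "length xs = k"
    define n where "n = (LEAST n. H (n # xs) = 0)"
    have n: "H (n # xs) = 0"
      unfolding n_def by (rule LeastI_ex[OF assms(2)[OF len]])
    have less: "H (i # xs) \<noteq> 0" if "i < n" for i
      using not_less_Least[of i "\<lambda>n. H (n # xs) = 0"] that unfolding n_def by blast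
    have "evaluates A h (i # xs) (H (i # xs))" for i
      by (rule h) (simp add: len)
    then show "evaluates A (Mu h) xs (LEAST n. H (n # xs) = 0)"
      using n less unfolding n_def[symmetric] by (metis evaluates.Mu)
  qed
qed

lemma computable_arity_add:
  "computable_arity A k F \<Longrightarrow> computable_arity A k G \<Longrightarrow> computable_arity A k (\<lambda>xs. F xs + G xs)"
proof (rule computable_arity_comp2[where f="(+)"])
  have "computable_arity A (Suc 1) (\<lambda>xs. rec_nat (tl xs ! 0) (\<lambda>n r. Suc ((n # r # tl xs) ! 1)) (hd xs))"
    by (intro computable_arity_rec computable_arity_Suc computable_arity_proj) auto
  moreover have "rec_nat a (\<lambda>n. Suc) b = b + a" for a b :: nat
    by (induction b) auto
  ultimately have "computable_arity A 2 (\<lambda>xs. hd xs + tl xs ! 0)"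
    by (simp add: numeral_2_eq_2)
  then show "computable_arity A 2 (\<lambda>xs. xs ! 0 + xs ! 1)"
    by (rule computable_arity_cong) (auto simp: numeral_2_eq_2 length_Suc_conv)
qed


lemma computable_arity_diff:
  "computable_arity A k F \<Longrightarrow> computable_arity A k G \<Longrightarrow> computable_arity A k (\<lambda>xs. F xs - G xs)"
proof (rule computable_arity_comp2[where f="(-)"])
  have "computable_arity A (Suc 0) (\<lambda>xs. rec_nat 0 (\<lambda>n r. (n # r # tl xs) ! 0) (hd xs))"
    by (intro computable_arity_rec computable_arity_zero computable_arity_proj) auto
  moreover have "rec_nat 0 (\<lambda>n r. n) b = b - 1" for b :: nat
    by (cases b) auto
  ultimately have "computable_arity A 1 (\<lambda>xs. hd xs - 1)" by simp
  then have pred: "computable_arity A 1 (\<lambda>xs. xs ! 0 - 1)"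
    by (rule computable_arity_cong) (auto simp: length_Suc_conv)
  \<comment> \<open>The iterated predecessor recurses on the subtrahend, and recursion runs on the
    first argument; the composition at the end swaps the arguments.\<close>
  have "computable_arity A (Suc 1)
      (\<lambda>xs. rec_nat (tl xs ! 0) (\<lambda>n r. (n # r # tl xs) ! 1 - 1) (hd xs))"
    by (intro computable_arity_rec computable_arity_proj computable_arity_comp1[OF pred]) auto
  moreover have "rec_nat a (\<lambda>n r. r - 1) b = a - b" for a b :: nat
    by (induction b) auto
  ultimately have *: "computable_arity A 2 (\<lambda>xs. tl xs ! 0 - hd xs)"
    by (simp add: numeral_2_eq_2)
  have "computable_arity A 2 (\<lambda>xs. tl xs ! 0 - xs ! 0)"
    by (rule computable_arity_cong[OF *]) (auto simp: numeral_2_eq_2 length_Suc_conv)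
  then have **: "computable_arity A 2 (\<lambda>xs. xs ! 1 - xs ! 0)"
    by (rule computable_arity_cong) (auto simp: numeral_2_eq_2 length_Suc_conv)
  show "computable_arity A 2 (\<lambda>xs. xs ! 0 - xs ! 1)"
    by (rule computable_arity_comp2[where f="\<lambda>a b. b - a", OF **]) (auto intro: computable_arity_proj)
qed

lemma computable_arity_triangle:
  "computable_arity A k F \<Longrightarrow> computable_arity A k (\<lambda>xs. triangle (F xs))"
proof (rule computable_arity_comp1[where f=triangle])
  have "computable_arity A (Suc 0) (\<lambda>xs. rec_nat 0
      (\<lambda>n r. (n # r # tl xs) ! 1 + Suc ((n # r # tl xs) ! 0)) (hd xs))"
    by (intro computable_arity_rec computable_arity_zero computable_arity_proj
        computable_arity_add computable_arity_Suc) auto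
  moreover have "rec_nat 0 (\<lambda>n r. r + Suc n) b = triangle b" for b :: nat
    by (induction b) auto
  ultimately have "computable_arity A 1 (\<lambda>xs. triangle (hd xs))" by simp
  then show "computable_arity A 1 (\<lambda>xs. triangle (xs ! 0))"
    by (rule computable_arity_cong) (auto simp: length_Suc_conv)
qed

section \<open>Cantor pairing and its projections\<close>

abbreviation pair :: "nat \<Rightarrow> nat \<Rightarrow> nat" where
  "pair a b \<equiv> prod_encode (a, b)"

definition pfst :: "nat \<Rightarrow> nat" where "pfst n = fst (prod_decode n)"
definition psnd :: "nat \<Rightarrow> nat" where "psnd n = snd (prod_decode n)"

lemma pfst_pair [simp]: "pfst (pair a b) = a"
  and psnd_pair [simp]: "psnd (pair a b) = b"
  and pair_pfst_psnd [simp]: "pair (pfst n) (psnd n) = n"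
  by (simp_all add: pfst_def psnd_def)

lemma computable_arity_pair:
  "computable_arity A k F \<Longrightarrow> computable_arity A k G \<Longrightarrow> computable_arity A k (\<lambda>xs. pair (F xs) (G xs))"
  unfolding prod_encode_def prod.case
  by (intro computable_arity_add computable_arity_triangle)

lemma triangle_mono: "a \<le> b \<Longrightarrow> triangle a \<le> triangle b"
  by (induction b) (auto simp: le_Suc_eq)

text \<open>\<open>pair a b\<close> is at least \<open>triangle (a + b)\<close> and less than the
  next triangular number, so a + b can be found by search. The truncated difference turns this
  comparison into the vanishing condition of \<open>computable_arity_Least\<close>.\<close>

lemma Least_triangle_pair: "(LEAST w. Suc (pair a b) - triangle (Suc w) = 0) = a + b"
proof (rule Least_equality)
  show "Suc (pair a b) - triangle (Suc (a + b)) = 0"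
    by (simp add: prod_encode_def)
next
  fix w assume w: "Suc (pair a b) - triangle (Suc w) = 0"
  show "a + b \<le> w"
  proof (rule ccontr)
    assume "\<not> a + b \<le> w"
    then have "triangle (Suc w) \<le> triangle (a + b)" by (intro triangle_mono) simp
    with w show False unfolding prod_encode_def by simp
  qed
qed

lemma computable_arity_Least_triangle:
  "computable_arity A 1 (\<lambda>xs. LEAST w. Suc (xs ! 0) - triangle (Suc w) = 0)"
proof -
  have "computable_arity A 1
      (\<lambda>xs. LEAST w. Suc ((w # xs) ! 1) - triangle (Suc ((w # xs) ! 0)) = 0)"
  proof (rule computable_arity_Least)
    show "computable_arity A (Suc 1) (\<lambda>xs. Suc (xs ! 1) - triangle (Suc (xs ! 0)))"
      by (intro computable_arity_diff computable_arity_triangle computable_arity_Suc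
          computable_arity_proj) auto
    fix xs :: "nat list"
    have "n \<le> triangle n" for n by (induction n) auto
    from this[of "Suc (xs ! 0)"]
    show "\<exists>n. Suc ((n # xs) ! 1) - triangle (Suc ((n # xs) ! 0)) = 0"
      by (intro exI[of _ "xs ! 0"]) simp
  qed
  then show ?thesis by simp
qed

lemma computable_arity_pfst: "computable_arity A 1 (\<lambda>xs. pfst (xs ! 0))"
  and computable_arity_psnd: "computable_arity A 1 (\<lambda>xs. psnd (xs ! 0))"
proof -
  let ?w = "\<lambda>xs. LEAST w. Suc (xs ! 0) - triangle (Suc w) = 0"
  have fst_eq: "n - triangle (LEAST w. Suc n - triangle (Suc w) = 0) = pfst n" for n
  proof -
    have "n = triangle (pfst n + psnd n) + pfst n"
      using pair_pfst_psnd[of n] unfolding prod_encode_def by simp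
    then show ?thesis using Least_triangle_pair[of "pfst n" "psnd n"] by simp
  qed
  have w_eq: "(LEAST w. Suc n - triangle (Suc w) = 0) - pfst n = psnd n" for n
    using Least_triangle_pair[of "pfst n" "psnd n"] by simp
  have "computable_arity A 1 (\<lambda>xs. xs ! 0 - triangle (?w xs))"
    by (intro computable_arity_diff computable_arity_triangle computable_arity_Least_triangle
        computable_arity_proj) auto
  then show *: "computable_arity A 1 (\<lambda>xs. pfst (xs ! 0))"
    unfolding fst_eq .
  have "computable_arity A 1 (\<lambda>xs. ?w xs - pfst (xs ! 0))"
    by (intro computable_arity_diff computable_arity_Least_triangle *)
  then show "computable_arity A 1 (\<lambda>xs. psnd (xs ! 0))"
    unfolding w_eq .
qed

text \<open>Several arguments are packed into one with \<^const>\<open>prod_encode\<close>,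
  so that every closure property below is a syntax-directed introduction rule.\<close>

definition computable :: "(nat \<Rightarrow> nat) \<Rightarrow> (nat \<Rightarrow> nat) \<Rightarrow> bool" where
  "computable A F \<longleftrightarrow> (\<exists>e. \<forall>n. evaluates A e [n] (F n))"

definition decidable :: "(nat \<Rightarrow> nat) \<Rightarrow> (nat \<Rightarrow> bool) \<Rightarrow> bool" where
  "decidable A P \<longleftrightarrow> computable A (\<lambda>n. of_bool (P n))"

lemma computable_iff: "computable A F \<longleftrightarrow> computable_arity A 1 (\<lambda>xs. F (xs ! 0))"
proof -
  have "(\<forall>n. evaluates A e [n] (F n)) \<longleftrightarrow> (\<forall>xs. length xs = 1 \<longrightarrow> evaluates A e xs (F (xs ! 0)))" for e
    by (auto simp: length_Suc_conv)
  then show ?thesis unfolding computable_def computable_arity_def by simp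
qed

section \<open>Closure rules for computable functions of one packed argument\<close>

named_theorems comp_intros

lemma computable_id [comp_intros]: "computable A (\<lambda>p. p)"
  unfolding computable_iff by (rule computable_arity_proj) simp

lemma computable_Suc [comp_intros]: "computable A F \<Longrightarrow> computable A (\<lambda>p. Suc (F p))"
  unfolding computable_iff by (rule computable_arity_Suc)

lemma computable_const [comp_intros]: "computable A (\<lambda>p. c)"
proof (induction c)
  case 0 show ?case unfolding computable_iff by (rule computable_arity_zero)
next
  case (Suc c) then show ?case by (rule computable_Suc)
qed

lemma computable_oracle: "computable A F \<Longrightarrow> computable A (\<lambda>p. A (F p))"
  unfolding computable_iff by (rule computable_arity_oracle)

lemma computable_add [comp_intros]: "computable A F \<Longrightarrow> computable A G \<Longrightarrow> computable A (\<lambda>p. F p + G p)"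
  unfolding computable_iff by (rule computable_arity_add)

lemma computable_diff [comp_intros]: "computable A F \<Longrightarrow> computable A G \<Longrightarrow> computable A (\<lambda>p. F p - G p)"
  unfolding computable_iff by (rule computable_arity_diff)

lemma computable_pair [comp_intros]: "computable A F \<Longrightarrow> computable A G \<Longrightarrow> computable A (\<lambda>p. pair (F p) (G p))"
  unfolding computable_iff by (rule computable_arity_pair)

lemma computable_compose: "computable A f \<Longrightarrow> computable A F \<Longrightarrow> computable A (\<lambda>p. f (F p))"
  unfolding computable_iff by (rule computable_arity_comp1)

lemma computable_pfst [comp_intros]: "computable A F \<Longrightarrow> computable A (\<lambda>p. pfst (F p))"
  unfolding computable_iff by (rule computable_arity_comp1[where f=pfst]) (rule computable_arity_pfst)

lemma computable_psnd [comp_intros]: "computable A F \<Longrightarrow> computable A (\<lambda>p. psnd (F p))"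
  unfolding computable_iff by (rule computable_arity_comp1[where f=psnd]) (rule computable_arity_psnd)

lemma computable_rec [comp_intros]:
  assumes "computable A B" "computable A (\<lambda>q. H (pfst q) (pfst (psnd q)) (psnd (psnd q)))"
    and "computable A N"
  shows "computable A (\<lambda>p. rec_nat (B p) (\<lambda>n r. H n r p) (N p))"
proof -
  have B: "computable_arity A 1 (\<lambda>xs. B (xs ! 0))" using assms(1) unfolding computable_iff .
  have "computable_arity A 3 (\<lambda>xs. H (pfst (pair (xs ! 0) (pair (xs ! 1) (xs ! 2))))
      (pfst (psnd (pair (xs ! 0) (pair (xs ! 1) (xs ! 2)))))
      (psnd (psnd (pair (xs ! 0) (pair (xs ! 1) (xs ! 2))))))"
    using assms(2) unfolding computable_iff
    by (rule computable_arity_comp1) (intro computable_arity_pair computable_arity_proj; simp)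
  then have "computable_arity A (Suc (Suc 1)) (\<lambda>xs. H (xs ! 0) (xs ! 1) (xs ! 2))"
    by (simp add: numeral_3_eq_3)
  from computable_arity_rec[OF B this]
  have "computable_arity A 2 (\<lambda>xs. rec_nat (B (tl xs ! 0)) (\<lambda>n r. H n r (tl xs ! 0)) (hd xs))"
    by (simp add: numeral_2_eq_2)
  then have R: "computable_arity A 2 (\<lambda>xs. rec_nat (B (xs ! 1)) (\<lambda>n r. H n r (xs ! 1)) (xs ! 0))"
    by (rule computable_arity_cong) (auto simp: numeral_2_eq_2 length_Suc_conv)
  show ?thesis
    using assms(3) unfolding computable_iff
    by (intro computable_arity_comp2[where f="\<lambda>n p. rec_nat (B p) (\<lambda>n r. H n r p) n", OF R]
        computable_arity_proj) auto
qed

lemma computable_Least: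
  assumes "computable A (\<lambda>q. H (pfst q) (psnd q))" "\<And>p. \<exists>n. H n p = 0"
  shows "computable A (\<lambda>p. LEAST n. H n p = 0)"
proof -
  have "computable_arity A (Suc 1)
      (\<lambda>xs. H (pfst (pair (xs ! 0) (xs ! 1))) (psnd (pair (xs ! 0) (xs ! 1))))"
    using assms(1) unfolding computable_iff
    by (rule computable_arity_comp1) (intro computable_arity_pair computable_arity_proj; simp)
  then have "computable_arity A 1 (\<lambda>xs. LEAST n. (\<lambda>xs. H (xs ! 0) (xs ! 1)) (n # xs) = 0)"
    by (intro computable_arity_Least) (use assms(2) in auto)
  then show ?thesis unfolding computable_iff by simp
qed

lemma computable_mult [comp_intros]:
  assumes "computable A F" "computable A G" shows "computable A (\<lambda>p. F p * G p)"
proof -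
  \<comment> \<open>In the recursion step p has become a projection of the packed argument, so F has
    to be composed with that projection.\<close>
  have "computable A (\<lambda>p. rec_nat 0 (\<lambda>n r. r + F p) (G p))"
    by (intro comp_intros computable_compose[OF assms(1)] assms)
  moreover have "rec_nat 0 (\<lambda>n r. r + a) b = a * b" for a b :: nat
    by (induction b) auto
  ultimately show ?thesis by simp
qed

lemma computable_power [comp_intros]:
  assumes "computable A F" "computable A G" shows "computable A (\<lambda>p. F p ^ G p)"
proof -
  have "computable A (\<lambda>p. rec_nat 1 (\<lambda>n r. r * F p) (G p))"
    by (intro comp_intros computable_compose[OF assms(1)] assms)
  moreover have "rec_nat 1 (\<lambda>n r. r * a) b = a ^ b" for a b :: nat
    by (induction b) auto
  ultimately show ?thesis by simp
qed

lemma computable_sum [comp_intros]: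
  assumes "computable A (\<lambda>q. F (pfst q) (psnd q))" "computable A N"
  shows "computable A (\<lambda>p. \<Sum>i<N p. F i p)"
proof -
  \<comment> \<open>Inside the recursion the packed argument is (i, (r, p)), and F has to skip the
    accumulator r.\<close>
  have "computable A (\<lambda>q. F (pfst (pair (pfst q) (psnd (psnd q))))
      (psnd (pair (pfst q) (psnd (psnd q)))))"
    by (rule computable_compose[OF assms(1)]) (intro comp_intros)
  then have "computable A (\<lambda>q. F (pfst q) (psnd (psnd q)))" by simp
  then have "computable A (\<lambda>p. rec_nat 0 (\<lambda>n r. r + F n p) (N p))"
    by (intro comp_intros assms)
  moreover have "rec_nat 0 (\<lambda>n r. r + F n p) b = (\<Sum>i<b. F i p)" for p b
    by (induction b) auto
  ultimately show ?thesis by simp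
qed

section \<open>Closure rules for decidable predicates\<close>

lemma decidable_compose: "decidable A P \<Longrightarrow> computable A F \<Longrightarrow> decidable A (\<lambda>p. P (F p))"
  unfolding decidable_def by (rule computable_compose)

lemma decidable_le [comp_intros]:
  assumes "computable A F" "computable A G" shows "decidable A (\<lambda>p. F p \<le> G p)"
proof -
  have "computable A (\<lambda>p. 1 - (F p - G p))" by (intro comp_intros assms)
  moreover have "1 - (a - b) = of_bool (a \<le> b)" for a b :: nat by auto
  ultimately show ?thesis unfolding decidable_def by simp
qed

lemma decidable_not [comp_intros]:
  assumes "decidable A P" shows "decidable A (\<lambda>p. \<not> P p)"
proof -
  have "computable A (\<lambda>p. 1 - of_bool (P p))"
    using assms unfolding decidable_def by (intro comp_intros)
  moreover have "1 - of_bool Q = (of_bool (\<not> Q) :: nat)" for Q by (cases Q) simp_all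
  ultimately show ?thesis unfolding decidable_def by (simp only:)
qed

lemma decidable_and [comp_intros]:
  assumes "decidable A P" "decidable A Q" shows "decidable A (\<lambda>p. P p \<and> Q p)"
proof -
  have "computable A (\<lambda>p. of_bool (P p) * of_bool (Q p))"
    using assms unfolding decidable_def by (intro comp_intros)
  then show ?thesis unfolding decidable_def by (simp only: of_bool_conj)
qed

lemma decidable_or [comp_intros]:
  assumes "decidable A P" "decidable A Q" shows "decidable A (\<lambda>p. P p \<or> Q p)"
proof -
  have "decidable A (\<lambda>p. \<not> (\<not> P p \<and> \<not> Q p))" by (intro comp_intros assms)
  then show ?thesis by simp
qed

lemma decidable_imp [comp_intros]:
  assumes "decidable A P" "decidable A Q" shows "decidable A (\<lambda>p. P p \<longrightarrow> Q p)"
proof -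
  have "decidable A (\<lambda>p. \<not> P p \<or> Q p)" by (intro comp_intros assms)
  then show ?thesis by (simp only: imp_conv_disj)
qed

lemma decidable_less [comp_intros]:
  assumes "computable A F" "computable A G" shows "decidable A (\<lambda>p. F p < G p)"
proof -
  have "decidable A (\<lambda>p. \<not> G p \<le> F p)" by (intro comp_intros assms)
  then show ?thesis by (simp only: not_le)
qed

lemma decidable_eq [comp_intros]:
  fixes F G :: "nat \<Rightarrow> nat"
  assumes "computable A F" "computable A G" shows "decidable A (\<lambda>p. F p = G p)"
proof -
  have "decidable A (\<lambda>p. F p \<le> G p \<and> G p \<le> F p)" by (intro comp_intros assms)
  moreover have "a \<le> b \<and> b \<le> a \<longleftrightarrow> a = b" for a b :: nat by auto
  ultimately show ?thesis by (simp only:)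
qed

lemma computable_of_bool [comp_intros]: "decidable A P \<Longrightarrow> computable A (\<lambda>p. of_bool (P p))"
  unfolding decidable_def .

lemma computable_if [comp_intros]:
  assumes "decidable A P" "computable A F" "computable A G"
  shows "computable A (\<lambda>p. if P p then F p else G p)"
proof -
  have "computable A (\<lambda>p. of_bool (P p) * F p + of_bool (\<not> P p) * G p)" by (intro comp_intros assms)
  moreover have "of_bool Q * a + of_bool (\<not> Q) * b = (if Q then a else b)" for Q and a b :: nat
    by (cases Q) simp_all
  ultimately show ?thesis by (simp only:)
qed

lemma decidable_bex [comp_intros]:
  assumes "decidable A (\<lambda>q. P (pfst q) (psnd q))" "computable A N"
  shows "decidable A (\<lambda>p. \<exists>i<N p. P i p)"
proof -
  have "decidable A (\<lambda>p. 0 < (\<Sum>i<N p. of_bool (P i p) :: nat))" by (intro comp_intros assms)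
  moreover have "0 < (\<Sum>i<b. of_bool (P i p) :: nat) \<longleftrightarrow> (\<exists>i<b. P i p)" for b p
    by (auto simp: zero_less_iff_neq_zero)
  ultimately show ?thesis by simp
qed

lemma decidable_ball [comp_intros]:
  assumes "decidable A (\<lambda>q. P (pfst q) (psnd q))" "computable A N"
  shows "decidable A (\<lambda>p. \<forall>i<N p. P i p)"
proof -
  have "decidable A (\<lambda>p. \<not> (\<exists>i<N p. \<not> P i p))" by (intro comp_intros assms)
  then show ?thesis by simp
qed

lemma decidable_bex_le [comp_intros]:
  assumes "decidable A (\<lambda>q. P (pfst q) (psnd q))" "computable A N"
  shows "decidable A (\<lambda>p. \<exists>i\<le>N p. P i p)"
  unfolding less_Suc_eq_le[symmetric] by (intro comp_intros assms)

lemma decidable_ball_le [comp_intros]: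
  assumes "decidable A (\<lambda>q. P (pfst q) (psnd q))" "computable A N"
  shows "decidable A (\<lambda>p. \<forall>i\<le>N p. P i p)"
  unfolding less_Suc_eq_le[symmetric] by (intro comp_intros assms)

text \<open>The quotient counts the positive multiples of \<open>2 ^ G p\<close> not exceeding
  \<open>F p\<close>, hence is a bounded sum. It gives access to binary digits and so to
  \<open>set_decode\<close>.\<close>

lemma computable_div_power_2 [comp_intros]:
  assumes "computable A F" "computable A G" shows "computable A (\<lambda>p. F p div 2 ^ G p)"
proof -
  have *: "(\<Sum>i<a. of_bool (Suc i * b \<le> a)) = a div b" if "b > 0" for a b :: nat
  proof -
    have "{i. i < a \<and> Suc i * b \<le> a} = {..<a div b}"
    proof -
      have "Suc i * b \<le> a \<longleftrightarrow> i < a div b" for i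
        using that by (metis Suc_le_eq less_eq_div_iff_mult_less_eq)
      moreover have "i < a div b \<Longrightarrow> i < a" for i
        using div_le_dividend less_le_trans by blast
      ultimately show ?thesis by auto
    qed
    then have "(\<Sum>i | i < a \<and> Suc i * b \<le> a. 1) = a div b" by simp
    moreover have "(\<Sum>i<a. of_bool (Suc i * b \<le> a)) = (\<Sum>i | i < a \<and> Suc i * b \<le> a. 1::nat)"
      by (rule sum.mono_neutral_cong_right) auto
    ultimately show ?thesis by (rule trans[rotated])
  qed
  have "computable A (\<lambda>p. \<Sum>i<F p. of_bool (Suc i * 2 ^ G p \<le> F p))"
    by (intro comp_intros computable_compose[OF assms(1)] computable_compose[OF assms(2)] assms)
  moreover have "(\<Sum>i<F p. of_bool (Suc i * 2 ^ G p \<le> F p)) = F p div 2 ^ G p" for p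
    by (rule *) simp
  ultimately show ?thesis by (simp only:)
qed

lemma computable_div_2 [comp_intros]: "computable A F \<Longrightarrow> computable A (\<lambda>p. F p div 2)"
  using computable_div_power_2[of A F "\<lambda>_. 1"] by (simp add: computable_const)

lemma decidable_even [comp_intros]:
  assumes "computable A F" shows "decidable A (\<lambda>p. even (F p))"
proof -
  have "decidable A (\<lambda>p. F p = 2 * (F p div 2))" by (intro comp_intros assms)
  moreover have "n = 2 * (n div 2) \<longleftrightarrow> even n" for n :: nat by presburger
  ultimately show ?thesis by simp
qed

lemma decidable_set_decode [comp_intros]:
  assumes "computable A F" "computable A G" shows "decidable A (\<lambda>p. F p \<in> set_decode (G p))"
proof -
  have "decidable A (\<lambda>p. \<not> even (G p div 2 ^ F p))" by (intro comp_intros assms)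
  then show ?thesis by (simp add: set_decode_def)
qed

section \<open>A stage-by-stage enumeration of computations\<close>

fun recfun_encode :: "recfun \<Rightarrow> nat" where
  "recfun_encode Zero = pair 0 0"
| "recfun_encode Succ = pair 1 0"
| "recfun_encode (Proj i) = pair 2 i"
| "recfun_encode Oracle = pair 3 0"
| "recfun_encode (Comp f gs) = pair 4 (pair (recfun_encode f) (list_encode (map recfun_encode gs)))"
| "recfun_encode (PrimRec f g) = pair 5 (pair (recfun_encode f) (recfun_encode g))"
| "recfun_encode (Mu f) = pair 6 (recfun_encode f)"

abbreviation lcons :: "nat \<Rightarrow> nat \<Rightarrow> nat" where
  "lcons x xs \<equiv> Suc (pair x xs)"

definition ev :: "nat \<Rightarrow> nat \<Rightarrow> nat \<Rightarrow> nat" where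
  "ev e xs y = pair 0 (pair e (pair xs y))"
definition evs :: "nat \<Rightarrow> nat \<Rightarrow> nat \<Rightarrow> nat" where
  "evs gs xs ys = pair 1 (pair gs (pair xs ys))"
definition component :: "nat \<Rightarrow> nat \<Rightarrow> nat \<Rightarrow> nat" where
  "component i xs y = pair 2 (pair i (pair xs y))"
definition below :: "nat \<Rightarrow> nat \<Rightarrow> nat \<Rightarrow> nat" where
  "below f xs n = pair 3 (pair f (pair xs n))"

lemmas judgement_defs = ev_def evs_def component_def below_def

text \<open>Kleene's schemes as Horn clauses over codes: \<open>evs\<close>, \<open>component\<close> and \<open>below\<close> are auxiliary judgements for the
  argument lists of \<^const>\<open>Comp\<close>, for \<^const>\<open>Proj\<close> and for the positive values required by \<^const>\<open>Mu\<close>. The set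
  \<open>D\<close> holds the judgements available as premises; the bound \<open>s\<close> makes the relation decidable.\<close>

definition derivable :: "(nat \<Rightarrow> bool) \<Rightarrow> nat set \<Rightarrow> nat \<Rightarrow> nat \<Rightarrow> bool" where
  "derivable Z D s c \<longleftrightarrow>
    (\<exists>xs<s. c = ev (pair 0 0) xs 0)
  \<or> (\<exists>x<s. c = ev (pair 1 0) (lcons x 0) (Suc x))
  \<or> (\<exists>i<s. \<exists>xs<s. \<exists>y<s. component i xs y \<in> D \<and> c = ev (pair 2 i) xs y)
  \<or> (\<exists>x<s. c = ev (pair 3 0) (lcons x 0) (char_fun Z x))
  \<or> (\<exists>f<s. \<exists>gs<s. \<exists>xs<s. \<exists>ys<s. \<exists>z<s. evs gs xs ys \<in> D \<and> ev f ys z \<in> D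
        \<and> c = ev (pair 4 (pair f gs)) xs z)
  \<or> (\<exists>f<s. \<exists>g<s. \<exists>xs<s. \<exists>y<s. ev f xs y \<in> D \<and> c = ev (pair 5 (pair f g)) (lcons 0 xs) y)
  \<or> (\<exists>f<s. \<exists>g<s. \<exists>n<s. \<exists>r<s. \<exists>xs<s. \<exists>y<s. ev (pair 5 (pair f g)) (lcons n xs) r \<in> D
        \<and> ev g (lcons n (lcons r xs)) y \<in> D \<and> c = ev (pair 5 (pair f g)) (lcons (Suc n) xs) y)
  \<or> (\<exists>f<s. \<exists>n<s. \<exists>xs<s. ev f (lcons n xs) 0 \<in> D \<and> below f xs n \<in> D \<and> c = ev (pair 6 f) xs n)
  \<or> (\<exists>xs<s. c = evs 0 xs 0)
  \<or> (\<exists>g<s. \<exists>gs<s. \<exists>xs<s. \<exists>y<s. \<exists>ys<s. ev g xs y \<in> D \<and> evs gs xs ys \<in> D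
        \<and> c = evs (lcons g gs) xs (lcons y ys))
  \<or> (\<exists>xs<s. \<exists>y<s. c = component 0 (lcons y xs) y)
  \<or> (\<exists>i<s. \<exists>x<s. \<exists>xs<s. \<exists>y<s. component i xs y \<in> D \<and> c = component (Suc i) (lcons x xs) y)
  \<or> (\<exists>f<s. \<exists>xs<s. c = below f xs 0)
  \<or> (\<exists>f<s. \<exists>xs<s. \<exists>n<s. \<exists>v<s. below f xs n \<in> D \<and> ev f (lcons n xs) (Suc v) \<in> D
        \<and> c = below f xs (Suc n))"

text \<open>The cut-off at s makes each stage finite, so that it can be carried through a recursion
  as one number. Oracle questions are cut off as well, which gives
  \<open>stage_local\<close>.\<close>

primrec stage :: "(nat \<Rightarrow> bool) \<Rightarrow> nat \<Rightarrow> nat set" where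
  "stage Z 0 = {}"
| "stage Z (Suc s) = {c. c < Suc s \<and> derivable Z (stage Z s) s c}"

text \<open>Phrased with implications, in the style of \<open>disj_mono\<close> and
  \<open>conj_mono\<close>, so that monotonicity of \<open>derivable\<close> follows by resolution
  along its formula.\<close>

lemma ex_less_mono: "s \<le> t \<Longrightarrow> (\<And>i. P i \<longrightarrow> Q i) \<Longrightarrow> (\<exists>i<s. P i) \<longrightarrow> (\<exists>i<t. Q i)" for s t :: nat
  by (meson less_le_trans)

lemma derivable_mono: "D \<subseteq> D' \<Longrightarrow> s \<le> t \<Longrightarrow> derivable Z D s c \<Longrightarrow> derivable Z D' t c"
  unfolding derivable_def
  by (erule rev_mp) (intro ex_less_mono disj_mono conj_mono impI TrueI; (assumption | erule (1) subsetD | simp))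

lemma stage_mono_Suc: "stage Z s \<subseteq> stage Z (Suc s)"
proof (induction s)
  case (Suc s)
  show ?case
  proof
    fix c assume "c \<in> stage Z (Suc s)"
    then show "c \<in> stage Z (Suc (Suc s))"
      using derivable_mono[OF Suc, of s "Suc s" Z c] by simp
  qed
qed simp

lemma stage_mono: "s \<le> t \<Longrightarrow> stage Z s \<subseteq> stage Z t"
  by (rule lift_Suc_mono_le[of "stage Z"]) (rule stage_mono_Suc)

lemma stage_less: "c \<in> stage Z s \<Longrightarrow> c < s"
  by (cases s) auto

lemma finite_stage [simp]: "finite (stage Z s)"
  by (rule finite_subset[of _ "{..<s}"]) (auto dest: stage_less)

lemma stage_local: "(\<And>i. i < s \<Longrightarrow> Z i = Z' i) \<Longrightarrow> stage Z s = stage Z' s"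
proof (induction s)
  case (Suc s)
  have "derivable Z D s c \<longleftrightarrow> derivable Z' D s c" for D c
    unfolding derivable_def char_fun_def using Suc.prems by (simp cong: conj_cong)
  then show ?case using Suc by simp
qed simp

text \<open>The four kinds of judgement are treated together because the rules mix them. Nothing is
  claimed about codes that belong to no description.\<close>

definition stage_sound_at :: "(nat \<Rightarrow> nat) \<Rightarrow> nat \<Rightarrow> bool" where
  "stage_sound_at A c \<longleftrightarrow>
    (\<forall>e xs y. c = ev (recfun_encode e) (list_encode xs) y \<longrightarrow> evaluates A e xs y) \<and>
    (\<forall>gs xs ys. c = evs (list_encode (map recfun_encode gs)) (list_encode xs) (list_encode ys) \<longrightarrow>
       list_all2 (\<lambda>g y. evaluates A g xs y) gs ys) \<and>
    (\<forall>i xs y. c = component i (list_encode xs) y \<longrightarrow> i < length xs \<and> xs ! i = y) \<and>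
    (\<forall>f xs n. c = below (recfun_encode f) (list_encode xs) n \<longrightarrow>
       (\<forall>i<n. \<exists>v. v \<noteq> 0 \<and> evaluates A f (i # xs) v))"

lemma list_encode_eq_lcons:
  "list_encode xs = lcons a b \<longleftrightarrow> (\<exists>ys. xs = a # ys \<and> b = list_encode ys)"
  "lcons a b = list_encode xs \<longleftrightarrow> (\<exists>ys. xs = a # ys \<and> b = list_encode ys)"
  by (cases xs; auto)+

lemma list_encode_eq_0: "list_encode xs = 0 \<longleftrightarrow> xs = []" "0 = list_encode xs \<longleftrightarrow> xs = []"
  by (cases xs; auto)+

lemma list_encode_surj: "\<exists>xs. n = list_encode xs"
  by (metis list_decode_inverse)

lemma recfun_encode_inversion:
  "pair 0 0 = recfun_encode e \<Longrightarrow> e = Zero"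
  "pair (Suc 0) 0 = recfun_encode e \<Longrightarrow> e = Succ"
  "pair 2 i = recfun_encode e \<Longrightarrow> e = Proj i"
  "pair 3 0 = recfun_encode e \<Longrightarrow> e = Oracle"
  "pair 4 (pair a b) = recfun_encode e \<Longrightarrow> \<exists>f gs. e = Comp f gs \<and> a = recfun_encode f
     \<and> b = list_encode (map recfun_encode gs)"
  "pair 5 (pair a b) = recfun_encode e \<Longrightarrow> \<exists>f g. e = PrimRec f g \<and> a = recfun_encode f
     \<and> b = recfun_encode g"
  "pair 6 a = recfun_encode e \<Longrightarrow> \<exists>f. e = Mu f \<and> a = recfun_encode f"
  by (cases e; simp)+

lemma derivable_sound:
  assumes D: "\<And>c. c \<in> D \<Longrightarrow> stage_sound_at (char_fun Z) c" and c: "derivable Z D s c"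
  shows "stage_sound_at (char_fun Z) c"
proof -
  let ?A = "char_fun Z"
  have ev: "evaluates ?A e xs y" if "ev (recfun_encode e) (list_encode xs) y \<in> D" for e xs y
    using D[OF that] unfolding stage_sound_at_def by blast
  have evs: "list_all2 (\<lambda>g y. evaluates ?A g xs y) gs ys"
    if "evs (list_encode (map recfun_encode gs)) (list_encode xs) (list_encode ys) \<in> D" for gs xs ys
    using D[OF that] unfolding stage_sound_at_def by blast
  have component: "i < length xs \<and> xs ! i = y" if "component i (list_encode xs) y \<in> D" for i xs y
    using D[OF that] unfolding stage_sound_at_def by blast
  have below: "\<forall>i<n. \<exists>v. v \<noteq> 0 \<and> evaluates ?A f (i # xs) v"
    if "below (recfun_encode f) (list_encode xs) n \<in> D" for f xs n
    using D[OF that] unfolding stage_sound_at_def by blast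
  show ?thesis
    using c unfolding derivable_def
  proof (elim disjE exE conjE)
    fix xs assume "c = ev (pair 0 0) xs 0"
    then show ?thesis
      unfolding stage_sound_at_def judgement_defs
      by (auto dest!: recfun_encode_inversion intro: evaluates.Zero)
  next
    fix x assume "c = ev (pair 1 0) (lcons x 0) (Suc x)"
    then show ?thesis
      unfolding stage_sound_at_def judgement_defs
      by (auto dest!: recfun_encode_inversion intro: evaluates.Succ
          simp: list_encode_eq_lcons list_encode_eq_0)
  next
    fix i xs y assume a: "component i xs y \<in> D" and c: "c = ev (pair 2 i) xs y"
    have "evaluates ?A (Proj i) xs' y" if "xs = list_encode xs'" for xs'
      using component a evaluates.Proj that by blast
    then show ?thesis
      unfolding c stage_sound_at_def judgement_defs by (auto dest!: recfun_encode_inversion)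
  next
    fix x assume "c = ev (pair 3 0) (lcons x 0) (?A x)"
    then show ?thesis
      unfolding stage_sound_at_def judgement_defs
      by (auto dest!: recfun_encode_inversion intro: evaluates.Oracle
          simp: list_encode_eq_lcons list_encode_eq_0)
  next
    fix f gs xs ys z
    assume a: "evs gs xs ys \<in> D" "ev f ys z \<in> D" and c: "c = ev (pair 4 (pair f gs)) xs z"
    \<comment> \<open>The conclusion of this rule does not mention ys; that it codes a list comes
      from the surjectivity of \<open>list_encode\<close>.\<close>
    obtain ys' where ys: "ys = list_encode ys'" using list_encode_surj by blast
    show ?thesis
      using a unfolding c stage_sound_at_def ys
      using evaluates.Comp[OF evs ev]
      by (auto simp: judgement_defs dest!: recfun_encode_inversion)
  next
    fix f g xs y
    assume "ev f xs y \<in> D" "c = ev (pair 5 (pair f g)) (lcons 0 xs) y"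
    then show ?thesis
      using evaluates.PrimRec_0[OF ev] unfolding stage_sound_at_def
      by (auto simp: judgement_defs list_encode_eq_lcons dest!: recfun_encode_inversion)
  next
    fix f g n r xs y
    assume a: "ev (pair 5 (pair f g)) (lcons n xs) r \<in> D" "ev g (lcons n (lcons r xs)) y \<in> D"
      and c: "c = ev (pair 5 (pair f g)) (lcons (Suc n) xs) y"
    have "evaluates ?A (PrimRec f' g') (Suc n # xs') y"
      if "f = recfun_encode f'" "g = recfun_encode g'" "xs = list_encode xs'" for f' g' xs'
      by (rule evaluates.PrimRec_Suc[where r=r]) (rule ev; use a that in simp)+
    then show ?thesis
      unfolding c stage_sound_at_def
      by (auto simp: judgement_defs list_encode_eq_lcons dest!: recfun_encode_inversion)
  next
    fix f n xs
    assume "ev f (lcons n xs) 0 \<in> D" "below f xs n \<in> D" and c: "c = ev (pair 6 f) xs n"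
    then have "evaluates ?A (Mu f') xs' n"
      if "f = recfun_encode f'" "xs = list_encode xs'" for f' xs'
      by (intro evaluates.Mu ev below) (use that in simp_all)
    then show ?thesis
      unfolding c stage_sound_at_def by (auto simp: judgement_defs dest!: recfun_encode_inversion)
  next
    fix xs assume "c = evs 0 xs 0"
    then show ?thesis
      unfolding stage_sound_at_def by (auto simp: judgement_defs list_encode_eq_0)
  next
    fix g gs xs y ys
    assume a: "ev g xs y \<in> D" "evs gs xs ys \<in> D" and c: "c = evs (lcons g gs) xs (lcons y ys)"
    then show ?thesis
      using ev evs unfolding c stage_sound_at_def
      by (auto simp: judgement_defs list_encode_eq_lcons map_eq_Cons_conv Cons_eq_map_conv)
  next
    fix xs y assume "c = component 0 (lcons y xs) y"
    then show ?thesis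
      unfolding stage_sound_at_def by (auto simp: judgement_defs list_encode_eq_lcons)
  next
    fix i x xs y assume "component i xs y \<in> D" "c = component (Suc i) (lcons x xs) y"
    then show ?thesis
      using component unfolding stage_sound_at_def by (auto simp: judgement_defs list_encode_eq_lcons)
  next
    fix f xs assume "c = below f xs 0"
    then show ?thesis
      unfolding stage_sound_at_def by (auto simp: judgement_defs)
  next
    fix f xs n v
    assume a: "below f xs n \<in> D" "ev f (lcons n xs) (Suc v) \<in> D" and c: "c = below f xs (Suc n)"
    have "\<forall>i<Suc n. \<exists>v. v \<noteq> 0 \<and> evaluates ?A f' (i # xs') v"
      if "f = recfun_encode f'" "xs = list_encode xs'" for f' xs'
    proof -
      have "evaluates ?A f' (n # xs') (Suc v)" by (rule ev) (use a that in simp)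
      moreover have "\<forall>i<n. \<exists>v. v \<noteq> 0 \<and> evaluates ?A f' (i # xs') v" using below a that by simp
      ultimately show ?thesis by (metis less_Suc_eq nat.distinct(1))
    qed
    then show ?thesis
      unfolding c stage_sound_at_def by (auto simp: judgement_defs)
  qed
qed

lemma stage_sound:
  "ev (recfun_encode e) (list_encode xs) y \<in> stage Z s \<Longrightarrow> evaluates (char_fun Z) e xs y"
proof -
  have "c \<in> stage Z s \<Longrightarrow> stage_sound_at (char_fun Z) c" for c
    by (induction s arbitrary: c) (auto intro: derivable_sound)
  then show "ev (recfun_encode e) (list_encode xs) y \<in> stage Z s \<Longrightarrow> evaluates (char_fun Z) e xs y"
    unfolding stage_sound_at_def by blast
qed

section \<open>Completeness of the stages\<close>

definition provable :: "(nat \<Rightarrow> bool) \<Rightarrow> nat \<Rightarrow> bool" where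
  "provable Z c \<longleftrightarrow> (\<exists>s. c \<in> stage Z s)"

lemma provableI:
  assumes "c < Suc s" "derivable Z (stage Z s) s c" shows "provable Z c"
  using assms unfolding provable_def by (metis (mono_tags) mem_Collect_eq stage.simps(2))

lemma provable_stage:
  assumes "\<And>c. c \<in> set cs \<Longrightarrow> provable Z c"
  shows "\<exists>s\<ge>b. \<forall>c\<in>set cs. c \<in> stage Z s"
  using assms
proof (induction cs)
  case (Cons c cs)
  then obtain s where s: "s \<ge> b" "\<forall>c\<in>set cs. c \<in> stage Z s" by auto
  obtain t where "c \<in> stage Z t" using Cons.prems[of c] unfolding provable_def by auto
  with s show ?case
    using stage_mono[of t "max s t" Z] stage_mono[of s "max s t" Z]
    by (intro exI[of _ "max s t"]) auto
qed auto

text \<open>Premises obtained at different stages are brought to a common one, chosen also above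
  \<open>b\<close>, which bounds the parameters of the rule, and above the conclusion.\<close>

lemma provable_rule:
  assumes "\<And>s. b \<le> s \<Longrightarrow> set cs \<subseteq> stage Z s \<Longrightarrow> derivable Z (stage Z s) s c"
    and "\<And>d. d \<in> set cs \<Longrightarrow> provable Z d"
  shows "provable Z c"
proof -
  obtain s where "s \<ge> b + c" "\<forall>c\<in>set cs. c \<in> stage Z s"
    using provable_stage[OF assms(2)] by blast
  then show ?thesis using assms(1)[of s] by (intro provableI[of c s]) auto
qed

lemma provable_intros:
  "provable Z (ev (pair 0 0) xs 0)"
  "provable Z (ev (pair 1 0) (lcons x 0) (Suc x))"
  "provable Z (component i xs y) \<Longrightarrow> provable Z (ev (pair 2 i) xs y)"
  "provable Z (ev (pair 3 0) (lcons x 0) (char_fun Z x))"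
  "provable Z (evs gs xs ys) \<Longrightarrow> provable Z (ev f ys z) \<Longrightarrow> provable Z (ev (pair 4 (pair f gs)) xs z)"
  "provable Z (ev f xs y) \<Longrightarrow> provable Z (ev (pair 5 (pair f g)) (lcons 0 xs) y)"
  "provable Z (ev (pair 5 (pair f g)) (lcons n xs) r) \<Longrightarrow> provable Z (ev g (lcons n (lcons r xs)) y)
    \<Longrightarrow> provable Z (ev (pair 5 (pair f g)) (lcons (Suc n) xs) y)"
  "provable Z (ev f (lcons n xs) 0) \<Longrightarrow> provable Z (below f xs n) \<Longrightarrow> provable Z (ev (pair 6 f) xs n)"
  "provable Z (evs 0 xs 0)"
  "provable Z (ev g xs y) \<Longrightarrow> provable Z (evs gs xs ys) \<Longrightarrow> provable Z (evs (lcons g gs) xs (lcons y ys))"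
  "provable Z (component 0 (lcons y xs) y)"
  "provable Z (component i xs y) \<Longrightarrow> provable Z (component (Suc i) (lcons x xs) y)"
  "provable Z (below f xs 0)"
  "provable Z (below f xs n) \<Longrightarrow> provable Z (ev f (lcons n xs) (Suc v)) \<Longrightarrow> provable Z (below f xs (Suc n))"
proof -
  note d = derivable_def judgement_defs
  show "provable Z (ev (pair 0 0) xs 0)"
    by (rule provable_rule[where cs="[]" and b="Suc xs"]) (auto simp: d)
  show "provable Z (ev (pair 1 0) (lcons x 0) (Suc x))"
    by (rule provable_rule[where cs="[]" and b="Suc x"]) (auto simp: d)
  show "provable Z (component i xs y) \<Longrightarrow> provable Z (ev (pair 2 i) xs y)"
    by (rule provable_rule[where cs="[component i xs y]" and b="Suc (i + xs + y)"]) (auto simp: d)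
  show "provable Z (ev (pair 3 0) (lcons x 0) (char_fun Z x))"
    by (rule provable_rule[where cs="[]" and b="Suc x"]) (auto simp: d)
  show "provable Z (evs gs xs ys) \<Longrightarrow> provable Z (ev f ys z) \<Longrightarrow> provable Z (ev (pair 4 (pair f gs)) xs z)"
    by (rule provable_rule[where cs="[evs gs xs ys, ev f ys z]" and b="Suc (f + gs + xs + ys + z)"])
      (force simp: d)+
  show "provable Z (ev f xs y) \<Longrightarrow> provable Z (ev (pair 5 (pair f g)) (lcons 0 xs) y)"
    by (rule provable_rule[where cs="[ev f xs y]" and b="Suc (f + g + xs + y)"]) (auto simp: d)
  show "provable Z (ev (pair 5 (pair f g)) (lcons n xs) r) \<Longrightarrow> provable Z (ev g (lcons n (lcons r xs)) y)
    \<Longrightarrow> provable Z (ev (pair 5 (pair f g)) (lcons (Suc n) xs) y)"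
    by (rule provable_rule[where cs="[ev (pair 5 (pair f g)) (lcons n xs) r,
          ev g (lcons n (lcons r xs)) y]" and b="Suc (f + g + n + r + xs + y)"]) (force simp: d)+
  show "provable Z (ev f (lcons n xs) 0) \<Longrightarrow> provable Z (below f xs n) \<Longrightarrow> provable Z (ev (pair 6 f) xs n)"
    by (rule provable_rule[where cs="[ev f (lcons n xs) 0, below f xs n]" and b="Suc (f + n + xs)"])
      (auto simp: d)
  show "provable Z (evs 0 xs 0)"
    by (rule provable_rule[where cs="[]" and b="Suc xs"]) (auto simp: d)
  show "provable Z (ev g xs y) \<Longrightarrow> provable Z (evs gs xs ys) \<Longrightarrow> provable Z (evs (lcons g gs) xs (lcons y ys))"
    by (rule provable_rule[where cs="[ev g xs y, evs gs xs ys]" and b="Suc (g + gs + xs + y + ys)"])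
      (auto simp: d)
  show "provable Z (component 0 (lcons y xs) y)"
    by (rule provable_rule[where cs="[]" and b="Suc (xs + y)"]) (auto simp: d)
  show "provable Z (component i xs y) \<Longrightarrow> provable Z (component (Suc i) (lcons x xs) y)"
    by (rule provable_rule[where cs="[component i xs y]" and b="Suc (i + x + xs + y)"]) (auto simp: d)
  show "provable Z (below f xs 0)"
    by (rule provable_rule[where cs="[]" and b="Suc (f + xs)"]) (auto simp: d)
  show "provable Z (below f xs n) \<Longrightarrow> provable Z (ev f (lcons n xs) (Suc v)) \<Longrightarrow> provable Z (below f xs (Suc n))"
    by (rule provable_rule[where cs="[below f xs n, ev f (lcons n xs) (Suc v)]" and b="Suc (f + xs + n + v)"])
      (force simp: d)+
qed

lemma provable_component: "i < length xs \<Longrightarrow> provable Z (component i (list_encode xs) (xs ! i))"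
proof (induction xs arbitrary: i)
  case (Cons x xs)
  then show ?case by (cases i) (auto intro: provable_intros)
qed simp

lemma provable_evaluates:
  "evaluates (char_fun Z) e xs y \<Longrightarrow> provable Z (ev (recfun_encode e) (list_encode xs) y)"
proof (induction rule: evaluates.induct)
  case (Comp xs gs ys f z)
  from Comp.IH(1) have "provable Z (evs (list_encode (map recfun_encode gs)) (list_encode xs) (list_encode ys))"
    by (induction rule: list_all2_induct) (auto intro: provable_intros)
  then show ?case using Comp.IH(2) by (auto intro: provable_intros)
next
  case (Mu f n xs)
  have "provable Z (below (recfun_encode f) (list_encode xs) m)" if "m \<le> n" for m
    using that
  proof (induction m)
    case (Suc m)
    then obtain v where "v \<noteq> 0" "provable Z (ev (recfun_encode f) (list_encode (m # xs)) v)"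
      using Mu.IH(2) by (meson Suc_le_eq)
    then show ?case using Suc by (cases v) (auto intro: provable_intros)
  qed (rule provable_intros)
  then show ?case using Mu.IH(1) by (auto intro: provable_intros)
next
  case (Succ x)
  then show ?case using provable_intros(2)[of Z x] by simp
qed (auto intro: provable_intros provable_component)

lemma evaluates_iff_stage:
  "evaluates (char_fun Z) e xs y \<longleftrightarrow> (\<exists>s. ev (recfun_encode e) (list_encode xs) y \<in> stage Z s)"
  using provable_evaluates stage_sound unfolding provable_def by blast

section \<open>Decidability of the stages\<close>

lemma decidable_compose2:
  assumes "decidable A (\<lambda>q. P (pfst q) (psnd q))" "computable A F" "computable A G"
  shows "decidable A (\<lambda>p. P (F p) (G p))"
  using decidable_compose[OF assms(1) computable_pair[OF assms(2,3)]] by simp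

lemma computable_ev [comp_intros]:
  "computable A F \<Longrightarrow> computable A G \<Longrightarrow> computable A H \<Longrightarrow> computable A (\<lambda>p. ev (F p) (G p) (H p))"
  unfolding ev_def by (intro comp_intros)

lemma computable_evs [comp_intros]:
  "computable A F \<Longrightarrow> computable A G \<Longrightarrow> computable A H \<Longrightarrow> computable A (\<lambda>p. evs (F p) (G p) (H p))"
  unfolding evs_def by (intro comp_intros)

lemma computable_component [comp_intros]:
  "computable A F \<Longrightarrow> computable A G \<Longrightarrow> computable A H \<Longrightarrow> computable A (\<lambda>p. component (F p) (G p) (H p))"
  unfolding component_def by (intro comp_intros)

lemma computable_below [comp_intros]:
  "computable A F \<Longrightarrow> computable A G \<Longrightarrow> computable A H \<Longrightarrow> computable A (\<lambda>p. below (F p) (G p) (H p))"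
  unfolding below_def by (intro comp_intros)

lemma decidable_derivable:
  assumes P: "decidable A (\<lambda>q. P (pfst q) (psnd q))"
  shows "decidable A (\<lambda>q. derivable (\<lambda>i. P i (pfst q)) (set_decode (pfst (psnd q)))
    (pfst (psnd (psnd q))) (psnd (psnd (psnd q))))"
  unfolding derivable_def char_fun_def
  by (intro comp_intros decidable_compose2[OF P])

text \<open>The simulated oracle may be any predicate decidable from A, uniformly in the argument p.
  This allows computations to be run with all finite oracles \<open>set_decode x\<close>.\<close>

lemma decidable_stage [comp_intros]:
  assumes P: "decidable A (\<lambda>q. P (pfst q) (psnd q))" and "computable A S" "computable A C"
  shows "decidable A (\<lambda>p. C p \<in> stage (\<lambda>i. P i p) (S p))"
proof -
  let ?step = "\<lambda>s d p. \<Sum>c<Suc s. of_bool (derivable (\<lambda>i. P i p) (set_decode d) s c) * 2 ^ c"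
  have *: "decidable A (\<lambda>q. derivable (\<lambda>i. P i (F q)) (set_decode (D q)) (S q) (C q))"
    if "computable A F" "computable A D" "computable A S" "computable A C" for F D S C
    using decidable_compose[OF decidable_derivable[OF P], of "\<lambda>q. pair (F q) (pair (D q) (pair (S q) (C q)))"]
    that by (simp add: computable_pair)
  have "decidable A (\<lambda>p. C p \<in> set_decode (rec_nat 0 (\<lambda>s d. ?step s d p) (S p)))"
    by (intro comp_intros * assms)
  moreover have "rec_nat 0 (\<lambda>s d. ?step s d p) s = set_encode (stage (\<lambda>i. P i p) s)" for s p
  proof (induction s)
    case (Suc s)
    have "set_encode (stage (\<lambda>i. P i p) (Suc s)) =
      (\<Sum>c<Suc s. of_bool (derivable (\<lambda>i. P i p) (stage (\<lambda>i. P i p) s) s c) * 2 ^ c)"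
      unfolding set_encode_def stage.simps
      by (rule sum.mono_neutral_cong_left) auto
    then show ?case by (simp only: Suc old.nat.simps set_encode_inverse finite_stage)
  qed simp
  ultimately show ?thesis by simp
qed

section \<open>Reading requirements and values from a set\<close>

text \<open>One bound p limits the length of the initial segment, the output and the stage, so that
  the predicate is decidable and depends only on the first p bits of X.\<close>

definition met :: "(nat \<Rightarrow> bool) \<Rightarrow> nat \<Rightarrow> nat \<Rightarrow> bool" where
  "met X p l \<longleftrightarrow>
    (\<exists>m\<le>p. \<exists>y<p. ev l (lcons (string_code (map X [0..<m])) 0) y \<in> stage (\<lambda>_. False) p)"

text \<open>An odd position \<open>h\<close> codes, in \<open>h div 2\<close>, a level, a functional, the numerator and the predecessor of
  the denominator of a rational, and padding that makes every combination occur at arbitrarily large positions.\<close>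

definition level :: "nat \<Rightarrow> nat" where "level h = pfst (h div 2)"
definition req_fun :: "nat \<Rightarrow> nat" where "req_fun h = pfst (psnd (h div 2))"
definition req_num :: "nat \<Rightarrow> nat" where "req_num h = pfst (psnd (psnd (h div 2)))"
definition req_den :: "nat \<Rightarrow> nat" where "req_den h = Suc (pfst (psnd (psnd (psnd (h div 2)))))"

text \<open>A requirement is dropped when a set of index at most its level is newly met. One whose level is not above
  that of an earlier requirement still in force is ignored: so the strings in between cannot add lower levels.\<close>

definition active :: "(nat \<Rightarrow> bool) \<Rightarrow> nat \<Rightarrow> nat \<Rightarrow> bool" where
  "active X p h \<longleftrightarrow> h < p \<and> odd h \<and> X h \<and> (\<forall>l\<le>level h. met X p l \<longrightarrow> met X h l) \<and>
    (\<forall>h'<h. odd h' \<and> X h' \<and> level h \<le> level h' \<longrightarrow>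
       (\<exists>l\<le>level h'. met X h l \<and> \<not> met X h' l))"

text \<open>The bound on y will make the position at which a value is accepted an upper bound for
  the output of the functional.\<close>

definition converges :: "nat \<Rightarrow> nat \<Rightarrow> nat \<Rightarrow> (nat \<Rightarrow> bool) \<Rightarrow> bool" where
  "converges e m s Z \<longleftrightarrow> (\<exists>y<s. ev e (lcons m 0) y \<in> stage Z s)"

text \<open>A member q of U is the value with index \<open>card (U \<inter> {..<q})\<close>.
  Convergence is demanded on all arguments up to that index, so that arguments whose values were
  accepted before position h are covered too and the class shrinks into
  \<open>total\<close>.\<close>

definition conv_class :: "nat \<Rightarrow> nat \<Rightarrow> nat set \<Rightarrow> (nat \<Rightarrow> bool) set" where
  "conv_class e h U = {Z. \<forall>q\<in>U. h \<le> q \<longrightarrow> (\<forall>m\<le>card (U \<inter> {..<q}). converges e m q Z)}"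

text \<open>The inequality \<open>num / den \<le> measure + budget\<close> multiplied by \<open>den * 2 ^ p\<close>; see \<open>admissible_iff\<close>.\<close>

definition admissible :: "(nat \<Rightarrow> bool) \<Rightarrow> nat \<Rightarrow> nat set \<Rightarrow> bool" where
  "admissible X p U \<longleftrightarrow> (\<forall>h<p. active X p h \<longrightarrow>
     req_num h * 2 ^ p \<le> req_den h *
       ((\<Sum>x<2 ^ p. of_bool ((\<lambda>i. i \<in> set_decode x) \<in> conv_class (req_fun h) h (insert p U)))
        + (\<Sum>l<p. of_bool (level h < l \<and> met X p l) * 2 ^ (p - l))))"

primrec successes :: "(nat \<Rightarrow> bool) \<Rightarrow> nat \<Rightarrow> nat set" where
  "successes X 0 = {}"
| "successes X (Suc p) = (if even p \<and> X p \<and> admissible X p (successes X p)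
     then insert p (successes X p) else successes X p)"

text \<open>At most one q qualifies, since the number of accepted positions exceeds n after it;
  \<open>LEAST\<close> presents it as an unbounded search.\<close>

definition value_of :: "(nat \<Rightarrow> bool) \<Rightarrow> nat \<Rightarrow> nat" where
  "value_of X n = (LEAST q. q \<in> successes X (Suc q) \<and> card (successes X q) = n)"

lemma successes_less: "q \<in> successes X p \<Longrightarrow> q < p"
  by (induction p) (auto split: if_splits)

lemma finite_successes [simp]: "finite (successes X p)"
  by (rule finite_subset[of _ "{..<p}"]) (auto dest: successes_less)

lemma mem_successes_mono: "p \<le> p' \<Longrightarrow> q < p \<Longrightarrow> q \<in> successes X p' \<longleftrightarrow> q \<in> successes X p"
  by (induction rule: dec_induct) auto

lemma successes_Int: "q \<le> p \<Longrightarrow> successes X p \<inter> {..<q} = successes X q"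
  using mem_successes_mono[of q p _ X] by (auto dest: successes_less)

lemma decidable_const [comp_intros]: "decidable A (\<lambda>p. b)"
  unfolding decidable_def by (rule computable_const)

section \<open>Computability from X of the procedure that reads it\<close>

context
  fixes X :: "nat \<Rightarrow> bool"
begin

lemma decidable_self [comp_intros]: "computable (char_fun X) F \<Longrightarrow> decidable (char_fun X) (\<lambda>p. X (F p))"
  using computable_oracle[of "char_fun X" F] unfolding decidable_def char_fun_def .

lemma computable_string_code [comp_intros]:
  assumes "computable (char_fun X) F" shows "computable (char_fun X) (\<lambda>p. string_code (map X [0..<F p]))"
proof -
  \<comment> \<open>The list is built from its end: after k rounds it consists of the last k
    bits.\<close>
  have "computable (char_fun X) (\<lambda>m. rec_nat 0 (\<lambda>k r. lcons (of_bool (X (m - Suc k))) r) m)"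
    by (intro comp_intros)
  moreover have "rec_nat 0 (\<lambda>k r. lcons (of_bool (X (m - Suc k))) r) k
      = string_code (map X [m - k..<m])" if "k \<le> m" for k m
    using that
  proof (induction k)
    case (Suc k)
    then have "[m - Suc k..<m] = (m - Suc k) # [m - k..<m]"
      by (simp add: upt_conv_Cons Suc_diff_Suc)
    then show ?case using Suc by (simp add: string_code_def)
  qed (simp add: string_code_def)
  ultimately have "computable (char_fun X) (\<lambda>m. string_code (map X [0..<m]))" by simp
  then show ?thesis by (rule computable_compose[OF _ assms])
qed

lemma decidable_met [comp_intros]:
  assumes "computable (char_fun X) P" "computable (char_fun X) L" shows "decidable (char_fun X) (\<lambda>p. met X (P p) (L p))"
proof -
  have "decidable (char_fun X) (\<lambda>q. met X (pfst q) (psnd q))" unfolding met_def by (intro comp_intros)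
  from decidable_compose2[of "char_fun X" "met X", OF this assms] show ?thesis .
qed

lemma computable_req [comp_intros]:
  assumes "computable (char_fun X) F"
  shows "computable (char_fun X) (\<lambda>p. level (F p))" "computable (char_fun X) (\<lambda>p. req_fun (F p))"
    "computable (char_fun X) (\<lambda>p. req_num (F p))" "computable (char_fun X) (\<lambda>p. req_den (F p))"
  unfolding level_def req_fun_def req_num_def req_den_def by (intro comp_intros assms)+

lemma decidable_active [comp_intros]:
  assumes "computable (char_fun X) P" "computable (char_fun X) H" shows "decidable (char_fun X) (\<lambda>p. active X (P p) (H p))"
proof -
  have "decidable (char_fun X) (\<lambda>q. active X (pfst q) (psnd q))" unfolding active_def by (intro comp_intros)
  from decidable_compose2[of "char_fun X" "active X", OF this assms] show ?thesis .
qed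

lemma decidable_converges [comp_intros]:
  assumes "computable (char_fun X) E" "computable (char_fun X) M" "computable (char_fun X) S" "computable (char_fun X) F"
  shows "decidable (char_fun X) (\<lambda>p. converges (E p) (M p) (S p) (\<lambda>i. i \<in> set_decode (F p)))"
proof -
  have "decidable (char_fun X) (\<lambda>q. converges (pfst q) (pfst (psnd q)) (pfst (psnd (psnd q)))
      (\<lambda>i. i \<in> set_decode (psnd (psnd (psnd q)))))"
    unfolding converges_def by (intro comp_intros)
  from decidable_compose[OF this, of "\<lambda>p. pair (E p) (pair (M p) (pair (S p) (F p)))"]
  show ?thesis using assms by (simp add: computable_pair)
qed

text \<open>Bounded quantifiers and a sum in place of the cardinality are forms for which closure
  rules are available.\<close>

lemma conv_class_iff:
  assumes "U \<subseteq> {..<k}"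
  shows "Z \<in> conv_class e h U \<longleftrightarrow> (\<forall>q<k. q \<in> U \<and> h \<le> q \<longrightarrow>
    (\<forall>m\<le>\<Sum>i<q. of_bool (i \<in> U). converges e m q Z))"
proof -
  have "(\<Sum>i<q. of_bool (i \<in> U)) = card (U \<inter> {..<q})" for q
    by (simp add: Int_commute)
  then show ?thesis using assms unfolding conv_class_def by auto
qed

text \<open>Accepted positions lie below the current one; cutting an arbitrary decoded set off there
  bounds every quantifier.\<close>

lemma decidable_admissible:
  "decidable (char_fun X) (\<lambda>q. admissible X (pfst q) (set_decode (psnd q) \<inter> {..<pfst q}))"
proof -
  have *: "Z \<in> conv_class e h (insert p (D \<inter> {..<p})) \<longleftrightarrow>
      (\<forall>q<Suc p. (q = p \<or> q \<in> D \<and> q < p) \<and> h \<le> q \<longrightarrow>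
        (\<forall>m\<le>\<Sum>i<q. of_bool (i = p \<or> i \<in> D \<and> i < p). converges e m q Z))" for Z e h p D
    by (subst conv_class_iff[where k="Suc p"]) auto
  show ?thesis
    unfolding admissible_def * by (intro comp_intros)
qed

lemma decidable_successes [comp_intros]:
  assumes "computable (char_fun X) P" "computable (char_fun X) Q" shows "decidable (char_fun X) (\<lambda>p. Q p \<in> successes X (P p))"
proof -
  let ?step = "\<lambda>p d. if even p \<and> X p \<and> admissible X p (set_decode d \<inter> {..<p}) then 2 ^ p + d else d"
  have "decidable (char_fun X) (\<lambda>p. Q p \<in> set_decode (rec_nat 0 ?step (P p)))"
    by (intro comp_intros assms decidable_compose2[OF decidable_admissible])
  moreover have "rec_nat 0 ?step p = set_encode (successes X p)" for p
  proof (induction p)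
    case (Suc p)
    have "successes X p \<inter> {..<p} = successes X p" "p \<notin> successes X p"
      by (auto dest: successes_less)
    then show ?case using Suc by (simp del: set_decode_plus_power_2)
  qed simp
  ultimately show ?thesis by simp
qed

lemma value_of_turing_reducible:
  assumes "\<And>n. \<exists>q. q \<in> successes X (Suc q) \<and> card (successes X q) = n"
  shows "value_of X \<le>\<^sub>T X"
proof -
  have card: "card (successes X q) = (\<Sum>i<q. of_bool (i \<in> successes X q))" for q
  proof -
    have "successes X q = {..<q} \<inter> successes X q" by (auto dest: successes_less)
    then show ?thesis by simp
  qed
  have "computable (char_fun X) (\<lambda>n. LEAST q. of_bool (\<not> (q \<in> successes X (Suc q) \<and> card (successes X q) = n)) = (0::nat))"
    unfolding card
    by (rule computable_Least, intro comp_intros) (use assms in \<open>auto simp: card[symmetric]\<close>)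
  then show ?thesis
    unfolding turing_reducible_def computable_def value_of_def by simp
qed

end

section \<open>Measure of classes given by finite prefixes\<close>

interpretation coin: prob_space fair_coin_measure
  unfolding fair_coin_measure_def by (intro prob_space_PiM measure_pmf.prob_space_axioms)

lemma space_fair_coin [simp]: "space fair_coin_measure = UNIV"
  by (simp add: fair_coin_measure_def space_PiM)

lemma cylinder:
  "{Z. \<forall>i<p. Z i = b i} \<in> sets fair_coin_measure"
  "measure fair_coin_measure {Z. \<forall>i<p. Z i = b i} = 1 / 2 ^ p"
proof -
  let ?M = "\<lambda>_::nat. measure_pmf (bernoulli_pmf (1/2))"
  interpret P: product_prob_space ?M UNIV ..
  have eq: "{Z. \<forall>i<p. Z i = b i} = prod_emb UNIV ?M {..<p} (Pi\<^sub>E {..<p} (\<lambda>i. {b i}))"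
    by (auto simp: prod_emb_def PiE_def Pi_def space_PiM)
  show "{Z. \<forall>i<p. Z i = b i} \<in> sets fair_coin_measure"
    unfolding eq fair_coin_measure_def by (rule sets_PiM_I) auto
  have half: "measure_pmf.prob (bernoulli_pmf (1/2)) {b i} = 1/2" for i
    by (cases "b i") (auto simp: measure_pmf_single)
  have "measure fair_coin_measure {Z. \<forall>i<p. Z i = b i}
      = (\<Prod>i<p. measure_pmf.prob (bernoulli_pmf (1/2)) {b i})"
    unfolding eq fair_coin_measure_def by (subst P.measure_PiM_emb) auto
  then show "measure fair_coin_measure {Z. \<forall>i<p. Z i = b i} = 1 / 2 ^ p"
    by (simp only: half) (simp add: power_one_over)
qed

text \<open>Such classes are the finite unions of cylinders of length p.\<close>

definition local_below :: "nat \<Rightarrow> (nat \<Rightarrow> bool) set \<Rightarrow> bool" where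
  "local_below p C \<longleftrightarrow> (\<forall>Z Z'. (\<forall>i<p. Z i = Z' i) \<longrightarrow> Z \<in> C \<longrightarrow> Z' \<in> C)"

lemma local_belowD: "local_below p C \<Longrightarrow> Z \<in> C \<Longrightarrow> (\<And>i. i < p \<Longrightarrow> Z i = Z' i) \<Longrightarrow> Z' \<in> C"
  unfolding local_below_def by blast

lemma set_decode_less: "x < 2 ^ p \<Longrightarrow> i \<in> set_decode x \<Longrightarrow> i < p"
proof (rule ccontr)
  assume "x < 2 ^ p" "i \<in> set_decode x" "\<not> i < p"
  moreover have "(2::nat) ^ p \<le> 2 ^ i" using \<open>\<not> i < p\<close> by (intro power_increasing) auto
  ultimately show False by (simp add: set_decode_def)
qed

lemma set_encode_less: "S \<subseteq> {..<p} \<Longrightarrow> set_encode S < 2 ^ p"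
proof -
  assume "S \<subseteq> {..<p}"
  then have "set_encode S \<le> (\<Sum>i<p. 2 ^ i)"
    unfolding set_encode_def by (intro sum_mono2) auto
  also have "\<dots> < 2 ^ p" by (induction p) auto
  finally show ?thesis .
qed

text \<open>The numbers below 2^p list the strings of length p, so the measure is a count. This is
  how a computable check can speak about measures.\<close>

lemma local_below_measure:
  assumes "local_below p C"
  shows "C \<in> sets fair_coin_measure"
    "measure fair_coin_measure C = (\<Sum>x<2 ^ p. of_bool ((\<lambda>i. i \<in> set_decode x) \<in> C)) / 2 ^ p"
proof -
  let ?cyl = "\<lambda>x. {Z. \<forall>i<p. Z i = (i \<in> set_decode x)}"
  let ?I = "{x. x < 2 ^ p \<and> (\<lambda>i. i \<in> set_decode x) \<in> C}"
  have C: "C = (\<Union>x\<in>?I. ?cyl x)"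
  proof safe
    fix Z assume "Z \<in> C"
    let ?x = "set_encode {i. i < p \<and> Z i}"
    have "?x < 2 ^ p" by (rule set_encode_less) auto
    moreover have Z: "Z \<in> ?cyl ?x" by simp
    moreover have "(\<lambda>i. i \<in> set_decode ?x) \<in> C"
      by (rule local_belowD[OF assms \<open>Z \<in> C\<close>]) (use Z in simp)
    ultimately show "Z \<in> (\<Union>x\<in>?I. ?cyl x)" by blast
  next
    fix x Z assume x: "(\<lambda>i. i \<in> set_decode x) \<in> C" "\<forall>i<p. Z i = (i \<in> set_decode x)"
    show "Z \<in> C" by (rule local_belowD[OF assms x(1)]) (use x(2) in simp)
  qed
  have fin: "finite ?I" by simp
  show "C \<in> sets fair_coin_measure"
    by (subst C) (intro sets.finite_UN fin cylinder)
  have disj: "disjoint_family_on ?cyl ?I"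
    unfolding disjoint_family_on_def
  proof (intro ballI impI)
    fix x y assume xy: "x \<in> ?I" "y \<in> ?I" "x \<noteq> y"
    then have "set_decode x \<noteq> set_decode y"
      using arg_cong[of "set_decode x" "set_decode y" set_encode] unfolding set_decode_inverse by blast
    then obtain i where i: "(i \<in> set_decode x) \<noteq> (i \<in> set_decode y)" by blast
    then have "i < p" using xy set_decode_less by blast
    show "?cyl x \<inter> ?cyl y = {}"
    proof (rule equals0I)
      fix Z assume "Z \<in> ?cyl x \<inter> ?cyl y"
      then have "Z i = (i \<in> set_decode x)" "Z i = (i \<in> set_decode y)" using \<open>i < p\<close> by blast+
      with i show False by blast
    qed
  qed
  have "measure fair_coin_measure (\<Union>x\<in>?I. ?cyl x) = (\<Sum>x\<in>?I. measure fair_coin_measure (?cyl x))"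
    by (rule coin.finite_measure_finite_Union[OF fin _ disj]) (rule image_subsetI, rule cylinder(1))
  then have "measure fair_coin_measure C = (\<Sum>x\<in>?I. measure fair_coin_measure (?cyl x))"
    unfolding C[symmetric] .
  also have "\<dots> = (\<Sum>x\<in>?I. 1) / 2 ^ p" by (simp only: cylinder sum_divide_distrib)
  also have "(\<Sum>x\<in>?I. 1::real) = (\<Sum>x<2 ^ p. of_bool ((\<lambda>i. i \<in> set_decode x) \<in> C))"
    by (rule sum.mono_neutral_cong_left) auto
  finally show "measure fair_coin_measure C
      = (\<Sum>x<2 ^ p. of_bool ((\<lambda>i. i \<in> set_decode x) \<in> C)) / 2 ^ p" .
qed

lemma local_below_converges: "q \<le> p \<Longrightarrow> local_below p {Z. converges e m q Z}"
  unfolding local_below_def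
proof (intro allI impI)
  fix Z Z' :: "nat \<Rightarrow> bool"
  assume "q \<le> p" "\<forall>i<p. Z i = Z' i" "Z \<in> {Z. converges e m q Z}"
  moreover from this have "stage Z q = stage Z' q" by (intro stage_local) simp
  ultimately show "Z' \<in> {Z. converges e m q Z}" by (simp add: converges_def)
qed

lemma local_below_conv_class:
  assumes "U \<subseteq> {..p}" shows "local_below p (conv_class e h U)"
  unfolding local_below_def
proof (intro allI impI)
  fix Z Z' :: "nat \<Rightarrow> bool"
  assume *: "\<forall>i<p. Z i = Z' i" "Z \<in> conv_class e h U"
  have "converges e m q Z'" if "q \<in> U" "converges e m q Z" for m q
    using local_below_converges[of q p e m] that * assms unfolding local_below_def by blast
  with * show "Z' \<in> conv_class e h U" unfolding conv_class_def by blast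
qed

lemma converges_measurable [measurable]: "{Z. converges e m q Z} \<in> sets fair_coin_measure"
  by (rule local_below_measure(1)[OF local_below_converges[OF order_refl]])

lemma conv_class_measurable [measurable]:
  assumes "finite U" shows "conv_class e h U \<in> sets fair_coin_measure"
proof -
  have "U \<subseteq> {..Max (insert 0 U)}" using assms by auto
  then show ?thesis by (rule local_below_measure(1)[OF local_below_conv_class])
qed

section \<open>Classes of oracles at which a functional is total\<close>

definition total_upto :: "nat \<Rightarrow> nat \<Rightarrow> (nat \<Rightarrow> bool) set" where
  "total_upto e n = {Z. \<forall>m\<le>n. \<exists>s. converges e m s Z}"

definition total :: "nat \<Rightarrow> (nat \<Rightarrow> bool) set" where
  "total e = {Z. \<forall>m. \<exists>s. converges e m s Z}"

lemma converges_mono: "s \<le> t \<Longrightarrow> converges e m s Z \<Longrightarrow> converges e m t Z"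
  unfolding converges_def using stage_mono[of s t Z] by (meson less_le_trans subsetD)

lemma Collect_all_measurable:
  "(\<And>i::nat. {Z. P i Z} \<in> sets fair_coin_measure) \<Longrightarrow> {Z. \<forall>i. P i Z} \<in> sets fair_coin_measure"
  using sets.sets_Collect_countable_All[of fair_coin_measure P] by simp

lemma Collect_ex_measurable:
  "(\<And>i::nat. {Z. P i Z} \<in> sets fair_coin_measure) \<Longrightarrow> {Z. \<exists>i. P i Z} \<in> sets fair_coin_measure"
  using sets.sets_Collect_countable_Ex[of fair_coin_measure P] by simp

lemma Collect_imp_measurable:
  "{Z. P Z} \<in> sets fair_coin_measure \<Longrightarrow> {Z. Q Z} \<in> sets fair_coin_measure
    \<Longrightarrow> {Z. P Z \<longrightarrow> Q Z} \<in> sets fair_coin_measure"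
  using sets.sets_Collect_imp[of fair_coin_measure Q P] by simp

lemma Collect_const_measurable: "{Z. b} \<in> sets fair_coin_measure"
  using sets.top[of fair_coin_measure] by (cases b) auto

lemma total_measurable [measurable]: "total e \<in> sets fair_coin_measure"
  unfolding total_def by (intro Collect_all_measurable Collect_ex_measurable converges_measurable)

lemma total_upto_measurable [measurable]: "total_upto e n \<in> sets fair_coin_measure"
  unfolding total_upto_def
  by (intro Collect_all_measurable Collect_ex_measurable Collect_imp_measurable
      Collect_const_measurable converges_measurable)

text \<open>Continuity from above, along a decreasing sequence with empty intersection. It supplies
  the small error required before a set is met.\<close>

lemma total_upto_diff_small:
  assumes "\<epsilon> > 0"
  shows "\<exists>n. \<forall>k\<ge>n. measure fair_coin_measure (total_upto e k - total e) < \<epsilon>"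
proof -
  have "(\<lambda>n. measure fair_coin_measure (total_upto e n - total e))
      \<longlonglongrightarrow> measure fair_coin_measure (\<Inter>n. total_upto e n - total e)"
  proof (rule coin.finite_Lim_measure_decseq)
    show "range (\<lambda>n. total_upto e n - total e) \<subseteq> coin.events"
      by (intro image_subsetI sets.Diff total_upto_measurable total_measurable)
    show "decseq (\<lambda>n. total_upto e n - total e)"
      unfolding decseq_def total_upto_def by auto
  qed
  moreover have "(\<Inter>n. total_upto e n - total e) = {}"
    unfolding total_upto_def total_def by auto
  ultimately have "(\<lambda>n. measure fair_coin_measure (total_upto e n - total e)) \<longlonglongrightarrow> 0"
    by (simp only: measure_empty)
  from order_tendstoD(2)[OF this assms] show ?thesis unfolding eventually_sequentially .
qed

text \<open>Continuity from below: at a member of \<open>total e\<close> finitely many arguments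
  have a common stage. This is why a fulfilled requirement permits one more value.\<close>

lemma converges_upto_large:
  assumes C: "C \<in> sets fair_coin_measure" and r: "r < measure fair_coin_measure (C \<inter> total e)"
  shows "\<exists>s0. \<forall>s\<ge>s0. r < measure fair_coin_measure (C \<inter> {Z. \<forall>m\<le>n. converges e m s Z} \<inter> total e)"
proof -
  let ?W = "\<lambda>s. C \<inter> {Z. \<forall>m\<le>n. converges e m s Z} \<inter> total e"
  have W: "?W s \<in> sets fair_coin_measure" for s
    by (intro sets.Int C total_measurable Collect_all_measurable Collect_imp_measurable
      Collect_const_measurable converges_measurable)
  have "incseq ?W" unfolding incseq_def using converges_mono by blast
  then have "(\<lambda>s. measure fair_coin_measure (?W s)) \<longlonglongrightarrow> measure fair_coin_measure (\<Union>s. ?W s)"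
    using W by (intro coin.finite_Lim_measure_incseq) auto
  moreover have "(\<Union>s. ?W s) = C \<inter> total e"
  proof (rule equalityI; rule subsetI)
    fix Z assume Z: "Z \<in> C \<inter> total e"
    then have "\<forall>m. \<exists>s. converges e m s Z" by (simp add: total_def)
    then obtain s where s: "\<And>m. converges e m (s m) Z" by metis
    have "converges e m (\<Sum>m\<le>n. s m) Z" if "m \<le> n" for m
      by (rule converges_mono[OF _ s]) (rule member_le_sum; use that in simp)
    with Z show "Z \<in> (\<Union>s. ?W s)" by blast
  qed auto
  ultimately have "(\<lambda>s. measure fair_coin_measure (?W s)) \<longlonglongrightarrow> measure fair_coin_measure (C \<inter> total e)"
    by simp
  from order_tendstoD(1)[OF this r] show ?thesis unfolding eventually_sequentially .
qed

section \<open>Budgets and surviving classes\<close>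

abbreviation "\<mu> \<equiv> measure fair_coin_measure"

definition agree :: "nat \<Rightarrow> (nat \<Rightarrow> bool) \<Rightarrow> (nat \<Rightarrow> bool) \<Rightarrow> bool" where
  "agree p X Y \<longleftrightarrow> (\<forall>i<p. X i = Y i)"

lemma agree_refl [simp]: "agree p X X"
  and agree_sym: "agree p X Y \<Longrightarrow> agree p Y X"
  and agree_trans: "agree p X Y \<Longrightarrow> agree q Y Z \<Longrightarrow> p \<le> q \<Longrightarrow> agree p X Z"
  and agree_le: "agree q X Y \<Longrightarrow> p \<le> q \<Longrightarrow> agree p X Y"
  by (auto simp: agree_def)

lemma met_local: "agree p X Y \<Longrightarrow> q \<le> p \<Longrightarrow> met X q l \<longleftrightarrow> met Y q l"
proof -
  assume a: "agree p X Y" "q \<le> p"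
  have eq: "map X [0..<m] = map Y [0..<m]" if "m \<le> q" for m
    using a that by (auto simp: agree_def)
  have "(\<exists>y<q. ev l (lcons (string_code (map X [0..<m])) 0) y \<in> stage (\<lambda>_. False) q) \<longleftrightarrow>
      (\<exists>y<q. ev l (lcons (string_code (map Y [0..<m])) 0) y \<in> stage (\<lambda>_. False) q)" if "m \<le> q" for m
    by (simp only: eq[OF that])
  then show ?thesis unfolding met_def by blast
qed

lemma ev_le: "e \<le> ev e xs y" "y \<le> ev e xs y"
  unfolding ev_def by (meson le_prod_encode_1 le_prod_encode_2 order_trans)+

lemma met_iff: "met X p l \<longleftrightarrow>
    (\<exists>m\<le>p. \<exists>y. ev l (lcons (string_code (map X [0..<m])) 0) y \<in> stage (\<lambda>_. False) p)"
  unfolding met_def by (meson ev_le(2) le_less_trans stage_less)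

lemma met_mono: "met X p l \<Longrightarrow> p \<le> q \<Longrightarrow> met X q l"
  unfolding met_iff using stage_mono[of p q "\<lambda>_. False"] by (meson order_trans subsetD)

text \<open>Hence the sum over l < p in the budget misses no set that has been met by p.\<close>

lemma met_less: "met X p l \<Longrightarrow> l < p"
  unfolding met_iff by (meson ev_le(1) le_less_trans stage_less)

lemma active_less: "active X p h \<Longrightarrow> h < p"
  and active_odd: "active X p h \<Longrightarrow> odd h"
  and active_bit: "active X p h \<Longrightarrow> X h"
  by (simp_all add: active_def)

lemma active_local:
  assumes "agree p X Y" "q \<le> p" shows "active X q h \<longleftrightarrow> active Y q h"
proof -
  have "active Y q h" if "agree p X Y" "active X q h" for X Y
  proof -
    have h: "h < q" using that(2) by (rule active_less)
    have eq: "X i = Y i" if "i < p" for i using \<open>agree p X Y\<close> that by (simp add: agree_def)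
    have m: "met X i l = met Y i l" if "i \<le> p" for i l
      using met_local[OF \<open>agree p X Y\<close> that] .
    show ?thesis
      using that(2) h assms(2) eq m unfolding active_def by (simp add: less_imp_le)
  qed
  with assms show ?thesis using agree_sym by blast
qed

lemma admissible_local:
  assumes "agree p X Y" shows "admissible X p U \<longleftrightarrow> admissible Y p U"
  unfolding admissible_def using active_local[OF assms order_refl] met_local[OF assms order_refl] by simp

lemma successes_local: "agree p X Y \<Longrightarrow> q \<le> p \<Longrightarrow> successes X q = successes Y q"
proof (induction q)
  case (Suc q)
  then have "admissible X q U \<longleftrightarrow> admissible Y q U" for U
    by (intro admissible_local) (simp add: agree_def)
  moreover have "X q = Y q" using Suc.prems by (simp add: agree_def)
  ultimately show ?case using Suc by simp
qed simp

definition threshold :: "nat \<Rightarrow> real" where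
  "threshold h = real (req_num h) / real (req_den h)"

definition budget :: "(nat \<Rightarrow> bool) \<Rightarrow> nat \<Rightarrow> nat \<Rightarrow> real" where
  "budget X p h = (\<Sum>l<p. of_bool (level h < l \<and> met X p l) / 2 ^ l)"

definition req_class :: "(nat \<Rightarrow> bool) \<Rightarrow> nat \<Rightarrow> nat \<Rightarrow> (nat \<Rightarrow> bool) set" where
  "req_class X p h = conv_class (req_fun h) h (successes X p)"

lemma budget_nonneg: "0 \<le> budget X p h"
  unfolding budget_def by (intro sum_nonneg) auto

lemma sum_inverse_powers_le: "(\<Sum>l<p. of_bool (j < l) / 2 ^ l) \<le> (1::real) / 2 ^ j"
proof -
  \<comment> \<open>The induction needs the geometric sum with its tail term, which is dropped
    afterwards.\<close>
  have "(\<Sum>l<p. of_bool (j < l) / 2 ^ l) \<le> (1::real) / 2 ^ j - (if j < p then 1 / 2 ^ (p - 1) else 0)"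
  proof (induction p)
    case (Suc p)
    show ?case
    proof (cases "j < p")
      case True
      then obtain k where "p = Suc k" by (cases p) auto
      with Suc True show ?thesis by (auto simp: field_simps)
    next
      case False
      with Suc show ?thesis by (cases "j = p") auto
    qed
  qed simp
  then show ?thesis by (smt (verit) divide_nonneg_nonneg zero_le_power)
qed

text \<open>Only sets of index above the level are charged, so a high level keeps the eventual loss
  small.\<close>

lemma budget_le: "budget X p h \<le> 1 / 2 ^ level h"
proof -
  have "budget X p h \<le> (\<Sum>l<p. of_bool (level h < l) / 2 ^ l)"
    unfolding budget_def by (intro sum_mono divide_right_mono) auto
  with sum_inverse_powers_le[of "level h" p] show ?thesis by linarith
qed

lemma budget_mono:
  assumes "p \<le> q" shows "budget X p h \<le> budget X q h"
proof -
  have "budget X p h \<le> (\<Sum>l<q. of_bool (level h < l \<and> met X p l) / 2 ^ l)"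
    unfolding budget_def using assms by (intro sum_mono2) auto
  also have "\<dots> \<le> budget X q h"
    unfolding budget_def using met_mono[OF _ assms] by (intro sum_mono divide_right_mono) auto
  finally show ?thesis .
qed

text \<open>This increase compensates for the part of a class outside \<open>total\<close> when the
  l-th set is met.\<close>

lemma budget_gain:
  assumes "p \<le> q" "met X q l" "\<not> met X p l" "level h < l"
  shows "budget X p h + 1 / 2 ^ l \<le> budget X q h"
proof -
  have l: "l < q" using met_less[OF assms(2)] .
  have "budget X p h + 1 / 2 ^ l
      \<le> (\<Sum>i<q. of_bool (level h < i \<and> met X p i) / 2 ^ i) + (\<Sum>i<q. if i = l then 1 / 2 ^ i else 0)"
    unfolding budget_def using assms(1) l by (intro add_mono sum_mono2) auto
  also have "\<dots> = (\<Sum>i<q. of_bool (level h < i \<and> met X p i) / 2 ^ i + (if i = l then 1 / 2 ^ i else 0))"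
    by (rule sum.distrib[symmetric])
  also have "\<dots> \<le> budget X q h"
    unfolding budget_def using assms by (intro sum_mono) (auto dest: met_mono)
  finally show ?thesis .
qed

lemma budget_local: "agree p X Y \<Longrightarrow> budget X p h = budget Y p h"
  unfolding budget_def using met_local[of p X Y p] by simp

lemma req_class_local: "agree p X Y \<Longrightarrow> req_class X p h = req_class Y p h"
  unfolding req_class_def using successes_local[of p X Y p] by simp

lemma req_den_pos: "0 < req_den h" by (simp add: req_den_def)

text \<open>A value p runs computations for p stages only, so the class for
  \<open>insert p U\<close> is still determined by p bits and the count over the strings of length p
  gives its exact measure.\<close>

lemma admissible_iff:
  assumes "U \<subseteq> {..<p}"
  shows "admissible X p U \<longleftrightarrow> (\<forall>h. active X p h \<longrightarrow>
    threshold h \<le> \<mu> (conv_class (req_fun h) h (insert p U)) + budget X p h)"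
proof -
  have "req_num h * 2 ^ p \<le> req_den h *
       ((\<Sum>x<2 ^ p. of_bool ((\<lambda>i. i \<in> set_decode x) \<in> conv_class (req_fun h) h (insert p U)))
        + (\<Sum>l<p. of_bool (level h < l \<and> met X p l) * 2 ^ (p - l)))
    \<longleftrightarrow> threshold h \<le> \<mu> (conv_class (req_fun h) h (insert p U)) + budget X p h" for h
  proof -
    define c where "c = (\<Sum>x<2 ^ p. of_bool ((\<lambda>i. i \<in> set_decode x) \<in> conv_class (req_fun h) h (insert p U)) :: nat)"
    define b where "b = (\<Sum>l<p. of_bool (level h < l \<and> met X p l) * 2 ^ (p - l) :: nat)"
    have "local_below p (conv_class (req_fun h) h (insert p U))"
      by (rule local_below_conv_class) (use assms in auto)
    from local_below_measure(2)[OF this]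
    have c: "\<mu> (conv_class (req_fun h) h (insert p U)) = real c / 2 ^ p"
      unfolding c_def by simp
    have "of_bool (level h < l \<and> met X p l) / (2::real) ^ l
        = real (of_bool (level h < l \<and> met X p l) * 2 ^ (p - l)) / 2 ^ p" if "l < p" for l
    proof -
      have "(2::real) ^ p = 2 ^ (p - l) * 2 ^ l" using that by (simp flip: power_add)
      then show ?thesis by simp
    qed
    then have b: "budget X p h = real b / 2 ^ p"
      unfolding budget_def b_def of_nat_sum sum_divide_distrib
      by (intro sum.cong) auto
    have "req_num h * 2 ^ p \<le> req_den h * (c + b) \<longleftrightarrow>
        real (req_num h * 2 ^ p) \<le> real (req_den h * (c + b))"
      by (rule of_nat_le_iff[symmetric])
    also have "\<dots> \<longleftrightarrow> threshold h \<le> real c / 2 ^ p + real b / 2 ^ p"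
      unfolding threshold_def using req_den_pos[of h] by (simp add: field_simps)
    finally show ?thesis unfolding c b c_def[symmetric] b_def[symmetric] .
  qed
  then show ?thesis
    unfolding admissible_def using active_less by blast
qed

lemma req_class_measurable [measurable]: "req_class X p h \<in> sets fair_coin_measure"
  unfolding req_class_def by (rule conv_class_measurable) simp

text \<open>Later values add conditions and leave the indices of the earlier ones unchanged.\<close>

lemma req_class_antimono: "p \<le> q \<Longrightarrow> req_class X q h \<subseteq> req_class X p h"
proof
  fix Z assume pq: "p \<le> q" and Z: "Z \<in> req_class X q h"
  show "Z \<in> req_class X p h"
    unfolding req_class_def conv_class_def mem_Collect_eq
  proof (intro ballI impI)
    fix s assume s: "s \<in> successes X p" "h \<le> s"
    have "s < p" using s(1) by (rule successes_less)
    then have "successes X q \<inter> {..<s} = successes X p \<inter> {..<s}" "s \<in> successes X q"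
      using pq s(1) mem_successes_mono[OF pq, of s X] by (simp_all add: successes_Int)
    with Z s(2) show "\<forall>m\<le>card (successes X p \<inter> {..<s}). converges (req_fun h) m s Z"
      unfolding req_class_def conv_class_def by force
  qed
qed

lemma conv_class_insert:
  assumes "U \<subseteq> {..<s}" "h \<le> s"
  shows "conv_class e h (insert s U) = conv_class e h U \<inter> {Z. \<forall>m\<le>card U. converges e m s Z}"
proof -
  have U: "insert s U \<inter> {..<q} = U \<inter> {..<q}" if "q \<in> U" for q using assms that by auto
  have s: "U \<inter> {..<s} = U" using assms by auto
  have "Z \<in> conv_class e h (insert s U) \<longleftrightarrow>
      Z \<in> conv_class e h U \<inter> {Z. \<forall>m\<le>card U. converges e m s Z}" for Z
    using assms(2) unfolding conv_class_def mem_Collect_eq ball_simps(7) Int_iff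
    by (simp add: U s conj_commute cong: ball_cong)
  then show ?thesis by blast
qed

section \<open>The forcing construction\<close>

declare successes.simps(2) [simp del]

text \<open>The forcing relation for the negation of being met: it speaks about all continuations of
  the first p bits.\<close>

definition never_met :: "(nat \<Rightarrow> bool) \<Rightarrow> nat \<Rightarrow> nat \<Rightarrow> bool" where
  "never_met X p l \<longleftrightarrow> (\<forall>Y q. agree p X Y \<longrightarrow> \<not> met Y q l)"

definition decided :: "(nat \<Rightarrow> bool) \<Rightarrow> nat \<Rightarrow> nat \<Rightarrow> bool" where
  "decided X p l \<longleftrightarrow> met X p l \<or> never_met X p l"

text \<open>In contrast to \<open>admissible_iff\<close>, the class is cut down to
  \<open>total\<close> and the inequality is strict. Strictness leaves room for waiting only
  finitely many stages for convergence.\<close>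

definition fulfilled :: "(nat \<Rightarrow> bool) \<Rightarrow> nat \<Rightarrow> nat \<Rightarrow> bool" where
  "fulfilled X p h \<longleftrightarrow> threshold h < \<mu> (req_class X p h \<inter> total (req_fun h)) + budget X p h"

text \<open>The second clause keeps every level below l occupied, which bars continuations from
  adding requirements there. The last clause ensures that no old bit of level at least l blocks a
  new requirement of level l.\<close>

definition good :: "(nat \<Rightarrow> bool) \<Rightarrow> nat \<Rightarrow> nat \<Rightarrow> bool" where
  "good X l p \<longleftrightarrow> (\<forall>l'<l. decided X p l') \<and>
    (\<forall>j<l. \<exists>h. active X p h \<and> level h = j) \<and>
    (\<forall>h. active X p h \<longrightarrow> level h < l \<and> fulfilled X p h) \<and>
    (\<forall>h<p. odd h \<and> X h \<and> l \<le> level h \<longrightarrow> (\<exists>l'\<le>level h. met X p l' \<and> \<not> met X h l'))"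

section \<open>Good conditions under extension\<close>

lemma decided_mono:
  assumes "decided X p l" "agree p X Y" "p \<le> q" shows "decided Y q l"
proof (cases "met X p l")
  case True
  then have "met Y p l" using met_local[OF assms(2)] by simp
  then show ?thesis using met_mono assms(3) unfolding decided_def by blast
next
  case False
  then have "never_met X p l" using assms(1) unfolding decided_def by blast
  then have "never_met Y q l"
    unfolding never_met_def using agree_trans[OF assms(2)] assms(3) by blast
  then show ?thesis unfolding decided_def by blast
qed

lemma decided_met:
  assumes "decided X p l" "agree p X Y" "met Y q l" shows "met X p l"
  using assms unfolding decided_def never_met_def by blast

context
  fixes X Y :: "nat \<Rightarrow> bool" and l p q :: nat
  assumes good: "good X l p" and agr: "agree p X Y" and pq: "p \<le> q"
begin

text \<open>Cancellation would take a newly met set of index at most \<open>level h\<close>, but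
  these sets are decided: met already, or met in no continuation.\<close>

lemma active_extend:
  assumes h: "active X p h" shows "active Y q h"
proof -
  have lev: "level h < l" using good h by (simp add: good_def)
  have hp: "h < p" using h by (rule active_less)
  have m: "met X i l' = met Y i l'" if "i \<le> p" for i l'
    using met_local[OF agr that] .
  have eq: "X i = Y i" if "i < p" for i using agr that by (simp add: agree_def)
  have "met Y h l'" if "l' \<le> level h" "met Y q l'" for l'
  proof -
    have "met X p l'" using good that lev agr decided_met[of X p l' Y q] by (auto simp: good_def)
    then have "met X h l'" using h that unfolding active_def by blast
    then show ?thesis using m hp by simp
  qed
  moreover have "active Y p h" using active_local[OF agr order_refl] h by blast
  ultimately show ?thesis using pq unfolding active_def by auto
qed

lemma active_restrict:
  assumes h: "active Y q h" and "h < p" shows "active X p h"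
proof -
  have "met Y h l'" if "l' \<le> level h" "met Y p l'" for l'
    using h that met_mono[OF that(2) pq] unfolding active_def by blast
  then have "active Y p h" using h \<open>h < p\<close> unfolding active_def by auto
  then show ?thesis using active_local[OF agr order_refl] by blast
qed

text \<open>Each level below l is held by a requirement that stays active in all continuations, and
  a later bit at an occupied level is ignored.\<close>

lemma active_new_level:
  assumes h: "active Y q h" and "p \<le> h" shows "l \<le> level h"
proof (rule ccontr)
  assume "\<not> l \<le> level h"
  then obtain h0 where h0: "active X p h0" "level h0 = level h"
    using good unfolding good_def by (metis not_le)
  have "active Y q h0" by (rule active_extend[OF h0(1)])
  moreover have "h0 < h" using active_less[OF h0(1)] \<open>p \<le> h\<close> by simp
  ultimately obtain l' where l': "l' \<le> level h0" "met Y h l'" "\<not> met Y h0 l'"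
    using h h0(2) unfolding active_def by (metis order_refl)
  then have "decided X p l'" using good h0(1) by (auto simp: good_def)
  then have "met X p l'" using decided_met agr l'(2) by blast
  then have "met Y q l'" using met_local[OF agr order_refl] met_mono pq by blast
  then show False using \<open>active Y q h0\<close> l' unfolding active_def by blast
qed

lemma cancelled_extend:
  assumes "h < p" "odd h" "Y h" "l \<le> level h"
  shows "\<exists>l'\<le>level h. met Y p l' \<and> \<not> met Y h l'"
proof -
  have "X h" using assms agr by (simp add: agree_def)
  then obtain l' where "l' \<le> level h" "met X p l'" "\<not> met X h l'"
    using good assms unfolding good_def by blast
  then show ?thesis using met_local[OF agr] assms(1) by (metis less_imp_le order_refl)
qed

text \<open>Without new requirement bits only the measure condition has to be checked again.\<close>

lemma good_extend:
  assumes bits: "\<And>h. p \<le> h \<Longrightarrow> h < q \<Longrightarrow> odd h \<Longrightarrow> \<not> Y h"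
    and ful: "\<And>h. active X p h \<Longrightarrow> fulfilled Y q h"
  shows "good Y l q"
  unfolding good_def
proof (intro conjI allI impI)
  fix l' assume "l' < l"
  then show "decided Y q l'" using good decided_mono[OF _ agr pq] by (auto simp: good_def)
next
  fix j assume "j < l"
  then show "\<exists>h. active Y q h \<and> level h = j"
    using good active_extend unfolding good_def by blast
next
  fix h assume h: "active Y q h"
  then have "active X p h"
    using bits active_restrict active_less active_odd active_bit by (metis not_le)
  then show "level h < l" "fulfilled Y q h" using ful good by (auto simp: good_def)
next
  fix h assume h: "h < q" "odd h \<and> Y h \<and> l \<le> level h"
  then have "h < p" using bits by (metis not_le)
  then show "\<exists>l'\<le>level h. met Y q l' \<and> \<not> met Y h l'"
    using cancelled_extend h met_mono pq by blast
qed

end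

lemma fulfilled_budget_mono:
  assumes "fulfilled X p h" "req_class Y q h = req_class X p h" "budget X p h \<le> budget Y q h"
  shows "fulfilled Y q h"
  using assms unfolding fulfilled_def by simp

lemma good_local:
  assumes "good X l p" "agree p X Y" shows "good Y l p"
  using assms(1) assms(2) order_refl
proof (rule good_extend)
  fix h assume "active X p h"
  then have "fulfilled X p h" using assms(1) by (simp add: good_def)
  then show "fulfilled Y p h"
    by (rule fulfilled_budget_mono) (simp_all add: req_class_local[OF assms(2)] budget_local[OF assms(2)])
qed simp

lemma successes_const:
  assumes "p \<le> q" "\<And>s. p \<le> s \<Longrightarrow> s < q \<Longrightarrow> s \<notin> successes X q"
  shows "successes X q = successes X p"
  using assms mem_successes_mono[OF assms(1), of _ X] by (auto dest: successes_less) (metis not_le successes_less)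

text \<open>Continuing with zeros introduces no requirement and proposes no value, which makes
  arbitrarily large positions accessible.\<close>

definition truncate :: "nat \<Rightarrow> (nat \<Rightarrow> bool) \<Rightarrow> nat \<Rightarrow> bool" where
  "truncate p X = (\<lambda>i. i < p \<and> X i)"

lemma agree_truncate: "agree p X (truncate p X)"
  by (simp add: agree_def truncate_def)

lemma successes_bit: "s \<in> successes X q \<Longrightarrow> X s \<and> even s"
  by (induction q) (auto simp: successes.simps(2) split: if_splits)

lemma successes_truncate:
  assumes "p \<le> q" shows "successes (truncate p X) q = successes X p"
proof -
  have "s \<notin> successes (truncate p X) q" if "p \<le> s" for s
    using successes_bit[of s "truncate p X" q] that by (auto simp: truncate_def)
  then have "successes (truncate p X) q = successes (truncate p X) p"
    by (intro successes_const[OF assms])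
  also have "\<dots> = successes X p"
    by (rule successes_local[OF agree_truncate order_refl, symmetric])
  finally show ?thesis .
qed

lemma good_truncate:
  assumes "good X l p" "p \<le> q" shows "good (truncate p X) l q"
  using assms(1) agree_truncate assms(2)
proof (rule good_extend)
  fix h assume "active X p h"
  then have "fulfilled X p h" using assms(1) by (simp add: good_def)
  moreover have "budget X p h \<le> budget (truncate p X) q h"
    using budget_local[OF agree_truncate] budget_mono[OF assms(2)] by metis
  moreover have "req_class (truncate p X) q h = req_class X p h"
    unfolding req_class_def successes_truncate[OF assms(2)] ..
  ultimately show "fulfilled (truncate p X) q h" using fulfilled_budget_mono by blast
qed (simp add: truncate_def)

section \<open>Accepting values\<close>

lemma finite_active: "finite {h. active X p h}"
  by (rule finite_subset[of _ "{..<p}"]) (auto dest: active_less)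

lemma finite_uniform_bound:
  assumes "finite H" "\<And>h. h \<in> H \<Longrightarrow> \<exists>n. \<forall>k\<ge>n. P h k"
  shows "\<exists>n::nat. \<forall>h\<in>H. \<forall>k\<ge>n. P h k"
proof -
  obtain f where f: "\<And>h k. h \<in> H \<Longrightarrow> f h \<le> k \<Longrightarrow> P h k" using assms(2) by metis
  have "P h k" if "h \<in> H" "Max (insert 0 (f ` H)) \<le> k" for h k
    using that assms(1) by (intro f) auto
  then show ?thesis by blast
qed

text \<open>The finitely many active requirements are fulfilled strictly, so from some stage on,
  demanding convergence up to the next index preserves all their inequalities. A single 1 at a large
  even position, after zeros, is then accepted.\<close>

lemma good_success:
  assumes good: "good X l p"
  shows "\<exists>Y s. p \<le> s \<and> agree p X Y \<and> good Y l (Suc s) \<and> successes Y (Suc s) = insert s (successes X p)"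
proof -
  let ?n = "card (successes X p)"
  let ?large = "\<lambda>h s. threshold h - budget X p h <
      \<mu> (req_class X p h \<inter> {Z. \<forall>m\<le>?n. converges (req_fun h) m s Z} \<inter> total (req_fun h))"
  have "\<exists>n. \<forall>s\<ge>n. ?large h s" if "h \<in> {h. active X p h}" for h
    by (rule converges_upto_large[OF req_class_measurable])
      (use good that in \<open>auto simp: good_def fulfilled_def\<close>)
  from finite_uniform_bound[of "{h. active X p h}" ?large, OF finite_active this]
  obtain s0 where s0: "\<And>h s. active X p h \<Longrightarrow> s \<ge> s0 \<Longrightarrow> ?large h s"
    by blast
  define s where "s = 2 * (s0 + p)"
  have s: "s0 \<le> s" "p \<le> s" "even s" by (auto simp: s_def)
  define X0 where "X0 = truncate p X"
  define Y where "Y = X0(s := True)"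
  have good0: "good X0 l s" unfolding X0_def by (rule good_truncate[OF good s(2)])
  have agr0: "agree s X0 Y" by (simp add: agree_def Y_def)
  have agrX: "agree p X X0" unfolding X0_def by (rule agree_truncate)
  have agr: "agree p X Y" using agree_trans[OF agrX agr0 s(2)] .
  have succ: "successes Y s = successes X p"
    using successes_local[OF agr0 order_refl] successes_truncate[OF s(2), of X] by (simp add: X0_def)
  \<comment> \<open>The check made at s concerns old requirements only, as the bits from p up to s
    are zero.\<close>
  have act: "active X p h" "h < s" if "active Y s h" for h
  proof -
    show "h < s" using that by (rule active_less)
    then have "X0 h" using active_bit[OF that] by (simp add: Y_def split: if_splits)
    then have "h < p" by (simp add: X0_def truncate_def)
    then show "active X p h" by (rule active_restrict[OF good agr s(2) that])
  qed
  have bud: "budget X p h \<le> budget Y s h" for h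
    using budget_local[OF agr] budget_mono[OF s(2), of Y h] by simp
  have sub: "successes X p \<subseteq> {..<s}" using s(2) by (auto dest: successes_less)
  have class_eq: "conv_class (req_fun h) h (insert s (successes X p))
      = req_class X p h \<inter> {Z. \<forall>m\<le>?n. converges (req_fun h) m s Z}" if "h \<le> s" for h
    unfolding req_class_def by (rule conv_class_insert[OF sub that])
  have large: "threshold h < \<mu> (conv_class (req_fun h) h (insert s (successes X p)) \<inter> total (req_fun h))
      + budget Y s h" if "active X p h" for h
    using s0[OF that s(1)] bud[of h] class_eq[of h] active_less[OF that] s(2) by simp
  have "admissible Y s (successes X p)"
    unfolding admissible_iff[OF sub]
  proof (intro allI impI)
    fix h assume "active Y s h"
    then have "threshold h < \<mu> (conv_class (req_fun h) h (insert s (successes X p)) \<inter> total (req_fun h))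
      + budget Y s h" by (intro large act)
    also have "\<mu> (conv_class (req_fun h) h (insert s (successes X p)) \<inter> total (req_fun h))
        \<le> \<mu> (conv_class (req_fun h) h (insert s (successes X p)))"
      by (intro coin.finite_measure_mono conv_class_measurable) auto
    finally show "threshold h \<le> \<mu> (conv_class (req_fun h) h (insert s (successes X p))) + budget Y s h"
      by simp
  qed
  then have succ': "successes Y (Suc s) = insert s (successes X p)"
    using s(3) succ by (simp add: Y_def successes.simps(2))
  have "good Y l (Suc s)"
    using good0 agr0 le_SucI[OF order_refl]
  proof (rule good_extend)
    fix h assume "s \<le> h" "h < Suc s" "odd h" then show "\<not> Y h" using s(3) by (simp add: less_Suc_eq)
  next
    fix h assume h: "active X0 s h"
    then have "active Y s h" using active_local[OF agr0 order_refl] by blast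
    with large[OF act(1)] budget_mono[of s "Suc s" Y h] show "fulfilled Y (Suc s) h"
      unfolding fulfilled_def req_class_def succ' by force
  qed
  with succ' s(2) agr show ?thesis by blast
qed

lemma good_many_successes:
  assumes "good X l p"
  shows "\<exists>Y q. p \<le> q \<and> agree p X Y \<and> good Y l q \<and> k \<le> card (successes Y q)"
proof (induction k)
  case 0 show ?case using assms by (intro exI[of _ X] exI[of _ p]) simp
next
  case (Suc k)
  then obtain Y q where Y: "p \<le> q" "agree p X Y" "good Y l q" "k \<le> card (successes Y q)" by blast
  obtain Y' s where Y': "q \<le> s" "agree q Y Y'" "good Y' l (Suc s)"
    "successes Y' (Suc s) = insert s (successes Y q)"
    using good_success[OF Y(3)] by blast
  have "s \<notin> successes Y q" using Y'(1) by (auto dest: successes_less)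
  then have "Suc k \<le> card (successes Y' (Suc s))" using Y(4) Y'(4) by simp
  then show ?case using Y Y' agree_trans[OF Y(2) Y'(2) Y(1)] by (meson le_SucI order_trans)
qed

text \<open>Accepting a value of index n puts the surviving classes inside \<open>total_upto\<close>
  at n; for large n the excess over \<open>total\<close> is small for all active requirements at
  once.\<close>

lemma good_small_error:
  assumes good: "good X l p" and "\<epsilon> > 0"
  shows "\<exists>Y q. p \<le> q \<and> agree p X Y \<and> good Y l q \<and> k \<le> card (successes Y q) \<and>
    (\<forall>h. active Y q h \<longrightarrow> \<mu> (req_class Y q h - total (req_fun h)) < \<epsilon>)"
proof -
  let ?small = "\<lambda>h n. \<mu> (total_upto (req_fun h) n - total (req_fun h)) < \<epsilon>"
  have "\<exists>N. \<forall>n\<ge>N. ?small h n" if "h \<in> {h. active X p h}" for h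
    by (rule total_upto_diff_small[OF \<open>\<epsilon> > 0\<close>])
  from finite_uniform_bound[of "{h. active X p h}" ?small, OF finite_active this]
  obtain N where N: "\<And>h n. active X p h \<Longrightarrow> N \<le> n \<Longrightarrow> ?small h n"
    by blast
  \<comment> \<open>With \<open>N\<close> values accepted, the index of the next one is at least
    \<open>N\<close>; the summand \<open>k\<close> is what makes the number of values grow without
    bound in the end.\<close>
  obtain Y q where Y: "p \<le> q" "agree p X Y" "good Y l q" "N + k \<le> card (successes Y q)"
    using good_many_successes[OF good] by blast
  obtain Y' s where Y': "q \<le> s" "agree q Y Y'" "good Y' l (Suc s)"
    "successes Y' (Suc s) = insert s (successes Y q)"
    using good_success[OF Y(3)] by blast
  have ps: "p \<le> Suc s" and agr: "agree p X Y'"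
    using Y Y' agree_trans[OF Y(2) Y'(2) Y(1)] by auto
  have sub: "successes Y q \<subseteq> {..<s}" using Y'(1) by (auto dest: successes_less)
  have "\<mu> (req_class Y' (Suc s) h - total (req_fun h)) < \<epsilon>" if h: "active Y' (Suc s) h" for h
  proof -
    \<comment> \<open>\<open>N\<close> was chosen for the requirements active at p; goodness of the
      final condition excludes any others.\<close>
    have "h < p"
    proof (rule ccontr)
      assume "\<not> h < p"
      then have "l \<le> level h" using active_new_level[OF good agr ps h] by simp
      then show False using Y'(3) h by (auto simp: good_def)
    qed
    then have "active X p h" by (rule active_restrict[OF good agr ps h])
    have "h \<le> s" using \<open>h < p\<close> Y(1) Y'(1) by simp
    have "req_class Y' (Suc s) h \<subseteq> total_upto (req_fun h) (card (successes Y q))"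
      unfolding req_class_def Y'(4) conv_class_insert[OF sub \<open>h \<le> s\<close>] total_upto_def by auto
    then have "\<mu> (req_class Y' (Suc s) h - total (req_fun h))
        \<le> \<mu> (total_upto (req_fun h) (card (successes Y q)) - total (req_fun h))"
      by (intro coin.finite_measure_mono sets.Diff total_upto_measurable total_measurable) auto
    also have "\<dots> < \<epsilon>" using N[OF \<open>active X p h\<close>] Y(4) by simp
    finally show ?thesis .
  qed
  moreover have "k \<le> card (successes Y' (Suc s))"
    using Y(4) Y'(4) card_insert_le[of "successes Y q" s] by simp
  ultimately show ?thesis using ps agr Y'(3) by blast
qed

text \<open>A continuation that meets the l-th set is otherwise arbitrary. Requirements that it
  introduces are cancelled by the meeting itself. Values that it contains have passed the check, and
  the part of the class outside \<open>total\<close>, less than 2^-l by \<open>small\<close>, is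
  made up for by the growth of the budget.\<close>

lemma good_decide:
  assumes good: "good X l p"
    and small: "\<And>h. active X p h \<Longrightarrow> \<mu> (req_class X p h - total (req_fun h)) < 1 / 2 ^ l"
  shows "\<exists>Y q. p \<le> q \<and> agree p X Y \<and> good Y l q \<and> decided Y q l"
proof (cases "decided X p l")
  case True
  then show ?thesis using good by (intro exI[of _ X] exI[of _ p]) simp
next
  case False
  then obtain Y q0 where Y: "agree p X Y" "met Y q0 l" and nX: "\<not> met X p l"
    unfolding decided_def never_met_def by blast
  have nY: "\<not> met Y p l" using nX met_local[OF Y(1) order_refl] by blast
  \<comment> \<open>Stopping at the first position where the set is met makes it newly met relative
    to every earlier position.\<close>
  define q where "q = (LEAST q. met Y q l)"
  have q: "met Y q l" unfolding q_def by (rule LeastI[of "\<lambda>q. met Y q l", OF Y(2)])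
  have least: "\<not> met Y i l" if "i < q" for i
    using not_less_Least[of i "\<lambda>q. met Y q l"] that unfolding q_def by blast
  have pq: "p \<le> q" using nY met_mono[OF q, of p] by (cases "p \<le> q") auto
  have old: "active X p h" if h: "active Y q h" for h
  proof (rule active_restrict[OF good Y(1) pq h], rule ccontr)
    assume "\<not> h < p"
    then have "l \<le> level h" using active_new_level[OF good Y(1) pq h] by simp
    then have "met Y h l" using h q unfolding active_def by blast
    then show False using least active_less[OF h] by blast
  qed
  have ful: "fulfilled Y q h" if h: "active Y q h" for h
  proof (cases "\<exists>s. p \<le> s \<and> s \<in> successes Y q")
    case False
    then have "successes Y q = successes X p"
      using successes_const[OF pq, of Y] successes_local[OF Y(1) order_refl] by metis
    moreover have "budget X p h \<le> budget Y q h"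
      using budget_local[OF Y(1)] budget_mono[OF pq, of Y h] by simp
    ultimately show ?thesis
      using good old[OF h] fulfilled_budget_mono[of X p h Y q] by (simp add: req_class_def good_def)
  next
    case True
    \<comment> \<open>The last accepted value suffices: the class checked at s already involves all
      values accepted before q.\<close>
    define s where "s = Max (successes Y q)"
    from True have ne: "successes Y q \<noteq> {}" by blast
    have sin: "s \<in> successes Y q" unfolding s_def by (rule Max_in) (simp_all add: ne)
    have smax: "t \<le> s" if "t \<in> successes Y q" for t unfolding s_def using that by simp
    have ps: "p \<le> s" using True smax order_trans by blast
    have sq: "s < q" using successes_less[OF sin] .
    have eq: "successes Y q = insert s (successes Y s)"
      using successes_Int[of s q Y] sq sin smax by (auto simp: le_less)
    have "s \<in> successes Y (Suc s)" using mem_successes_mono[of "Suc s" q s Y] sq sin by simp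
    then have "admissible Y s (successes Y s)" using successes_less[of s Y s]
      by (auto simp: successes.simps(2) split: if_splits)
    moreover have "active Y s h" by (rule active_extend[OF good Y(1) ps old[OF h]])
    moreover have "successes Y s \<subseteq> {..<s}" by (auto dest: successes_less)
    ultimately have adm: "threshold h \<le> \<mu> (req_class Y q h) + budget Y s h"
      unfolding req_class_def eq by (simp add: admissible_iff)
    \<comment> \<open>The part outside \<open>total\<close> can only have shrunk since p, where
      \<open>small\<close> bounds it.\<close>
    have "req_class Y q h \<subseteq> req_class X p h"
      using req_class_antimono[OF pq, of Y h] req_class_local[OF Y(1)] by simp
    then have "\<mu> (req_class Y q h) \<le> \<mu> ((req_class Y q h \<inter> total (req_fun h)) \<union> (req_class X p h - total (req_fun h)))"
      by (intro coin.finite_measure_mono) (auto intro!: sets.Un sets.Int sets.Diff)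
    also have "\<dots> \<le> \<mu> (req_class Y q h \<inter> total (req_fun h)) + \<mu> (req_class X p h - total (req_fun h))"
      by (intro measure_Un_le sets.Int sets.Diff req_class_measurable total_measurable)
    also have "\<dots> < \<mu> (req_class Y q h \<inter> total (req_fun h)) + 1 / 2 ^ l"
      using small[OF old[OF h]] by simp
    finally have "threshold h < \<mu> (req_class Y q h \<inter> total (req_fun h)) + (budget Y s h + 1 / 2 ^ l)"
      using adm by simp
    also have "budget Y s h + 1 / 2 ^ l \<le> budget Y q h"
      using good old[OF h] by (intro budget_gain less_imp_le[OF sq] q least[OF sq]) (auto simp: good_def)
    finally show ?thesis unfolding fulfilled_def by simp
  qed
  have "good Y l q"
    unfolding good_def
  proof (intro conjI allI impI)
    fix l' assume "l' < l"
    then show "decided Y q l'" using good decided_mono[OF _ Y(1) pq] by (auto simp: good_def)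
  next
    fix j assume "j < l"
    then show "\<exists>h. active Y q h \<and> level h = j"
      using good active_extend[OF good Y(1) pq] unfolding good_def by blast
  next
    fix h assume h: "active Y q h"
    then show "level h < l" using old good by (auto simp: good_def)
    show "fulfilled Y q h" using ful[OF h] .
  next
    fix h assume h: "h < q" "odd h \<and> Y h \<and> l \<le> level h"
    \<comment> \<open>The l-th set itself cancels these bits, being met at q and at no earlier
      position.\<close>
    show "\<exists>l'\<le>level h. met Y q l' \<and> \<not> met Y h l'"
      using h q least by blast
  qed
  with pq Y(1) q show ?thesis unfolding decided_def by blast
qed

section \<open>Introducing requirements\<close>

lemma total_Zero: "total (recfun_encode Zero) = UNIV"
proof -
  have "\<exists>s. converges (recfun_encode Zero) m s Z" for m Z
  proof -
    obtain s where s: "ev (recfun_encode Zero) (list_encode [m]) 0 \<in> stage Z s"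
      using evaluates_iff_stage[of Z Zero "[m]" 0] evaluates.Zero by blast
    then have "0 < s" using stage_less[OF s] by simp
    with s show ?thesis unfolding converges_def by auto
  qed
  then show ?thesis unfolding total_def by auto
qed

text \<open>Values accepted before h impose nothing on the class of h, so that class starts as the
  whole space and the requirement is fulfilled as soon as it is true. It becomes active because
  older bits of level at least l have been cancelled.\<close>

lemma good_introduce:
  assumes good: "good X l p" and dec: "decided X p l" and r: "real a / real (Suc b) < \<mu> (total e)"
  shows "\<exists>Y h. p \<le> h \<and> agree p X Y \<and> good Y (Suc l) (Suc h) \<and> successes Y (Suc h) = successes X p \<and>
    active Y (Suc h) h \<and> level h = l \<and> req_fun h = e \<and> threshold h = real a / real (Suc b)"
proof -
  \<comment> \<open>The last component is padding that keeps the position from falling below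
    p.\<close>
  define c where "c = pair l (pair e (pair a (pair b p)))"
  define h where "h = Suc (2 * c)"
  have "p \<le> c" unfolding c_def by (meson le_prod_encode_2 order_trans)
  then have ph: "p \<le> h" by (simp add: h_def)
  have "h div 2 = c" "odd h" by (simp_all add: h_def)
  then have req: "level h = l" "req_fun h = e" "threshold h = real a / real (Suc b)"
    by (simp_all add: level_def req_fun_def req_num_def req_den_def threshold_def c_def)
  define X0 where "X0 = truncate p X"
  define Y where "Y = X0(h := True)"
  have good0: "good X0 l h" unfolding X0_def by (rule good_truncate[OF good ph])
  have agr0: "agree h X0 Y" by (simp add: agree_def Y_def)
  have agrX: "agree p X X0" unfolding X0_def by (rule agree_truncate)
  have agr: "agree p X Y" using agree_trans[OF agrX agr0 ph] .
  have dec0: "decided X0 h l" by (rule decided_mono[OF dec agrX ph])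
  have below_p: "i < p" if "Y i" "i < h" for i
    using that by (simp add: Y_def X0_def truncate_def)
  have succ: "successes Y (Suc h) = successes X p"
    using successes_local[OF agr0 order_refl] successes_truncate[OF ph, of X] \<open>odd h\<close>
    by (simp add: X0_def successes.simps(2))
  note ext = good0 agr0 le_SucI[OF order_refl]
  have dec': "decided X0 h l'" if "l' \<le> l" for l'
    using good0 dec0 that by (cases "l' = l") (auto simp: good_def)
  have act: "active Y (Suc h) h"
  proof -
    have "met Y h l'" if "l' \<le> l" "met Y (Suc h) l'" for l'
      using decided_met[OF dec'[OF that(1)] agr0 that(2)] met_local[OF agr0 order_refl] by blast
    moreover have "\<exists>l'\<le>level h'. met Y h l' \<and> \<not> met Y h' l'"
      if "h' < h" "odd h'" "Y h'" "l \<le> level h'" for h'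
      using cancelled_extend[OF ext that] .
    ultimately show ?thesis using \<open>odd h\<close> req(1) unfolding active_def by (simp add: Y_def)
  qed
  have "good Y (Suc l) (Suc h)"
    unfolding good_def
  proof (intro conjI allI impI)
    fix l' assume "l' < Suc l"
    then show "decided Y (Suc h) l'" using decided_mono[OF dec' agr0] by simp
  next
    fix j assume "j < Suc l"
    then show "\<exists>h'. active Y (Suc h) h' \<and> level h' = j"
      using act req(1) good0 active_extend[OF ext] unfolding good_def less_Suc_eq by blast
  next
    fix h' assume h': "active Y (Suc h) h'"
    show "level h' < Suc l"
    proof (cases "h' = h")
      case False
      then have "h' < h" using active_less[OF h'] by simp
      then show ?thesis using active_restrict[OF ext h'] good0 by (auto simp: good_def)
    qed (simp add: req)
    show "fulfilled Y (Suc h) h'"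
    proof (cases "h' = h")
      case False
      then have "h' < h" using active_less[OF h'] by simp
      then have "active X0 h h'" using active_restrict[OF ext h'] by simp
      then have "fulfilled X0 h h'" using good0 by (simp add: good_def)
      moreover have "budget X0 h h' \<le> budget Y (Suc h) h'"
        using budget_local[OF agr0] budget_mono[of h "Suc h" Y h'] by simp
      moreover have "req_class Y (Suc h) h' = req_class X0 h h'"
        unfolding req_class_def succ using successes_truncate[OF ph, of X] by (simp add: X0_def)
      ultimately show ?thesis using fulfilled_budget_mono by blast
    next
      case True
      have "req_class Y (Suc h) h = UNIV"
        unfolding req_class_def succ conv_class_def using ph by (auto dest: successes_less)
      then show ?thesis
        using r budget_nonneg[of Y "Suc h" h] unfolding True fulfilled_def req by simp
    qed
  next
    fix h' assume h': "h' < Suc h" "odd h' \<and> Y h' \<and> Suc l \<le> level h'"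
    then have "h' < h" using req(1) by (cases "h' = h") auto
    then show "\<exists>l'\<le>level h'. met Y (Suc h) l' \<and> \<not> met Y h' l'"
      using cancelled_extend[OF ext, of h'] h' met_mono[of Y h _ "Suc h"] by auto
  qed
  with ph agr succ act req show ?thesis by blast
qed

text \<open>The free component k repeats every requirement at arbitrarily high levels, where its
  budget stays small.\<close>

definition requirement_at :: "nat \<Rightarrow> nat \<Rightarrow> nat \<Rightarrow> nat \<Rightarrow> bool" where
  "requirement_at l e a b \<longleftrightarrow> (\<exists>k. l = pair e (pair a (pair b k)))"

definition served :: "(nat \<Rightarrow> bool) \<Rightarrow> nat \<Rightarrow> nat \<Rightarrow> bool" where
  "served X p l \<longleftrightarrow>
    (\<forall>e a b. requirement_at l e a b \<and> real a / real (Suc b) < \<mu> (total e) \<longrightarrow>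
      (\<exists>h. active X p h \<and> level h = l \<and> req_fun h = e \<and> threshold h = real a / real (Suc b)))"

text \<open>The order matters: the error must be small before the l-th set is met, and the set must
  be decided before a requirement of level l is safe from cancellation.\<close>

lemma good_step:
  assumes good: "good X l p"
  shows "\<exists>Y q. p < q \<and> agree p X Y \<and> good Y (Suc l) q \<and> l \<le> card (successes Y q) \<and> served Y q l"
proof -
  obtain Y1 q1 where 1: "p \<le> q1" "agree p X Y1" "good Y1 l q1" "l \<le> card (successes Y1 q1)"
    "\<And>h. active Y1 q1 h \<Longrightarrow> \<mu> (req_class Y1 q1 h - total (req_fun h)) < 1 / 2 ^ l"
    using good_small_error[OF good, of "1 / 2 ^ l" l] by auto
  obtain Y2 q2 where 2: "q1 \<le> q2" "agree q1 Y1 Y2" "good Y2 l q2" "decided Y2 q2 l"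
    using good_decide[OF 1(3,5)] by blast
  define e a b where "e = pfst l" and "a = pfst (psnd l)" and "b = pfst (psnd (psnd l))"
  define good_req where "good_req \<longleftrightarrow> real a / real (Suc b) < \<mu> (total e)"
  \<comment> \<open>If the scheduled inequality is false, the everywhere total functional
    \<open>Zero\<close> with threshold 1/2 fills level l, since \<open>good\<close> wants every
    level occupied.\<close>
  have "\<exists>e' a' b'. real a' / real (Suc b') < \<mu> (total e') \<and> (good_req \<longrightarrow> e' = e \<and> a' = a \<and> b' = b)"
  proof (cases good_req)
    case False
    have "real 1 / real (Suc 1) < \<mu> (total (recfun_encode Zero))"
      unfolding total_Zero using coin.prob_space by simp
    with False show ?thesis by blast
  qed (auto simp: good_req_def)
  then obtain e' a' b' where r: "real a' / real (Suc b') < \<mu> (total e')"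
    and req: "good_req \<longrightarrow> e' = e \<and> a' = a \<and> b' = b" by blast
  obtain Y h where Y: "q2 \<le> h" "agree q2 Y2 Y" "good Y (Suc l) (Suc h)"
    "successes Y (Suc h) = successes Y2 q2" "active Y (Suc h) h" "level h = l" "req_fun h = e'"
    "threshold h = real a' / real (Suc b')"
    using good_introduce[OF 2(3,4) r] by blast
  have agr: "agree p X Y"
    using agree_trans[OF agree_trans[OF 1(2) 2(2) 1(1)] Y(2)] 1(1) 2(1) by simp
  have card: "l \<le> card (successes Y (Suc h))"
  proof -
    have "successes Y1 q1 \<subseteq> successes Y2 q2"
      using successes_Int[OF 2(1), of Y2] successes_local[OF 2(2) order_refl] by blast
    then have "card (successes Y1 q1) \<le> card (successes Y2 q2)" by (intro card_mono) auto
    then show ?thesis using 1(4) Y(4) by simp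
  qed
  have req: "\<exists>h'. active Y (Suc h) h' \<and> level h' = l \<and> req_fun h' = e'' \<and> threshold h' = real a'' / real (Suc b'')"
    if "requirement_at l e'' a'' b''" "real a'' / real (Suc b'') < \<mu> (total e'')" for e'' a'' b''
  proof -
    have "e'' = e" "a'' = a" "b'' = b"
      using that(1) by (auto simp: requirement_at_def e_def a_def b_def)
    then show ?thesis using that(2) req Y unfolding good_req_def by auto
  qed
  have pq: "p < Suc h" using 1(1) 2(1) Y(1) by simp
  show ?thesis
    unfolding served_def
  proof (rule exI[of _ Y], rule exI[of _ "Suc h"], intro conjI allI impI)
    fix e a b assume r: "requirement_at l e a b \<and> real a / real (Suc b) < \<mu> (total e)"
    show "\<exists>h'. active Y (Suc h) h' \<and> level h' = l \<and> req_fun h' = e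
      \<and> threshold h' = real a / real (Suc b)"
      by (rule req[OF conjunct1[OF r] conjunct2[OF r]])
  qed (fact pq agr Y(3) card)+
qed

section \<open>Genericity and domination\<close>

lemma good_0: "good X 0 0"
  by (auto simp: good_def dest: active_less)

text \<open>Goodness passes to the limit by \<open>good_local\<close>, and service by the
  persistence of active requirements. The \<open>Suc\<close> in the cardinality bound is there
  because the values of step l appear in the condition with index l + 1.\<close>

lemma generic_exists:
  "\<exists>G. \<forall>l. \<exists>p. good G l p \<and> l \<le> p \<and> l \<le> Suc (card (successes G p)) \<and> (\<forall>i<l. served G p i)"
proof -
  let ?P = "\<lambda>l x. good (fst x) l (snd x)"
  let ?Q = "\<lambda>l x y. snd x < snd y \<and> agree (snd x) (fst x) (fst y) \<and>
    l \<le> card (successes (fst y) (snd y)) \<and> served (fst y) (snd y) l"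
  have "\<exists>f. \<forall>l. ?P l (f l) \<and> ?Q l (f l) (f (Suc l))"
  proof (rule dependent_nat_choice)
    show "\<exists>x. ?P 0 x" using good_0 by auto
  next
    fix x :: "(nat \<Rightarrow> bool) \<times> nat" and l
    assume "?P l x"
    from good_step[OF this] obtain Y q where "snd x < q" "agree (snd x) (fst x) Y" "good Y (Suc l) q"
      "l \<le> card (successes Y q)" "served Y q l"
      by blast
    then show "\<exists>y. ?P (Suc l) y \<and> ?Q l x y" by (intro exI[of _ "(Y, q)"]) simp
  qed
  then obtain f where f: "\<And>l. ?P l (f l) \<and> ?Q l (f l) (f (Suc l))" by blast
  define X where "X l = fst (f l)" for l
  define p where "p l = snd (f l)" for l
  have good: "good (X l) l (p l)" for l using f[of l] by (simp add: X_def p_def)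
  have step: "p l < p (Suc l)" "agree (p l) (X l) (X (Suc l))" "l \<le> card (successes (X (Suc l)) (p (Suc l)))"
      "served (X (Suc l)) (p (Suc l)) l" for l
    using f[of l] by (simp_all add: X_def p_def)
  have p_mono: "p l \<le> p m" if "l \<le> m" for l m
    using that by (rule lift_Suc_mono_le[of p, rotated]) (simp add: step(1) less_imp_le)
  have p_ge: "l \<le> p l" for l
    by (induction l) (use step(1) le_less_trans Suc_leI in blast)+
  have agree_le: "agree (p l) (X l) (X m)" if "l \<le> m" for l m
    using that
  proof (induction rule: dec_induct)
    case (step m)
    then show ?case
      using agree_trans[OF step.IH \<open>\<And>l. agree (p l) (X l) (X (Suc l))\<close> p_mono[OF step.hyps(1)]] by simp
  qed simp
  \<comment> \<open>The condition with index i + 1 fixes bit i, since its length is at least i +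
    1.\<close>
  define G where "G i = X (Suc i) i" for i
  have G: "agree (p l) (X l) G" for l
    unfolding agree_def
  proof (intro allI impI)
    fix i assume i: "i < p l"
    show "X l i = G i"
    proof (cases "l \<le> Suc i")
      case True
      then show ?thesis using agree_le[OF True] i by (simp add: agree_def G_def)
    next
      case False
      have "i < p (Suc i)" using p_ge[of "Suc i"] by simp
      then show ?thesis using agree_le[of "Suc i" l] False by (simp add: agree_def G_def)
    qed
  qed
  have active_G: "active G (p m) h" if "active (X l) (p l) h" "l \<le> m" for l m h
    using active_extend[OF good[of l] G p_mono[OF that(2)] that(1)] .
  have "served G (p l) i" if "i < l" for l i
    using step(4)[of i] active_G[of "Suc i" _ l] that unfolding served_def by (meson Suc_leI)
  moreover have "good G l (p l)" for l by (rule good_local[OF good G])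
  moreover have "l \<le> Suc (card (successes G (p l)))" for l
    using step(3)[of "l - 1"] successes_local[OF G[of l] order_refl] by (cases l) auto
  ultimately show ?thesis using p_ge by blast
qed

section \<open>Genericity of the limit\<close>

lemma string_code_oracle: "char_fun (\<lambda>_. False) = (\<lambda>_. 0)"
  by (simp add: char_fun_def fun_eq_iff)

lemma met_sound:
  assumes "met G p (recfun_encode e)"
  shows "\<exists>\<sigma> y. initial_segment \<sigma> G \<and> evaluates (\<lambda>_. 0) e [string_code \<sigma>] y"
proof -
  obtain m y where "ev (recfun_encode e) (list_encode [string_code (map G [0..<m])]) y \<in> stage (\<lambda>_. False) p"
    using assms unfolding met_def by auto
  then have "evaluates (\<lambda>_. 0) e [string_code (map G [0..<m])] y"
    using stage_sound string_code_oracle by metis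
  moreover have "initial_segment (map G [0..<m]) G" by (simp add: initial_segment_def)
  ultimately show ?thesis by blast
qed

text \<open>The witness is \<tau> followed by zeros, read up to a position that covers both the
  length of \<tau> and the stage of the computation.\<close>

lemma met_complete:
  assumes "evaluates (\<lambda>_. 0) e [string_code \<tau>] y" and "prefix (map G [0..<p]) \<tau>"
  shows "\<not> never_met G p (recfun_encode e)"
proof -
  define Y where "Y = (\<lambda>i. i < length \<tau> \<and> \<tau> ! i)"
  have \<tau>: "map Y [0..<length \<tau>] = \<tau>" by (rule nth_equalityI) (auto simp: Y_def)
  have "agree p G Y"
    using assms(2) unfolding agree_def prefix_def Y_def by (auto simp: nth_append)
  moreover obtain s where "ev (recfun_encode e) (list_encode [string_code \<tau>]) y \<in> stage (\<lambda>_. False) s"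
    using assms(1) evaluates_iff_stage string_code_oracle by metis
  then have "ev (recfun_encode e) (list_encode [string_code \<tau>]) y \<in> stage (\<lambda>_. False) (max s (length \<tau>))"
    using stage_mono[of s "max s (length \<tau>)"] by auto
  then have "met Y (max s (length \<tau>)) (recfun_encode e)"
    unfolding met_iff by (intro exI[of _ "length \<tau>"] conjI exI[of _ y]) (simp_all add: \<tau>)
  ultimately show ?thesis unfolding never_met_def by blast
qed

lemma one_genericI:
  assumes "\<And>l. \<exists>p. decided G p l" shows "one_generic G"
  unfolding one_generic_def
proof (intro allI impI)
  fix S assume "re_strings S"
  then obtain e where S: "\<And>\<sigma>. \<sigma> \<in> S \<longleftrightarrow> (\<exists>y. evaluates (\<lambda>_. 0) e [string_code \<sigma>] y)"
    unfolding re_strings_def by blast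
  obtain p where "decided G p (recfun_encode e)" using assms by blast
  then consider "met G p (recfun_encode e)" | "never_met G p (recfun_encode e)"
    unfolding decided_def by blast
  then show "(\<exists>\<sigma>. initial_segment \<sigma> G \<and> \<sigma> \<in> S) \<or>
      (\<exists>\<rho>. initial_segment \<rho> G \<and> (\<forall>\<tau>. prefix \<rho> \<tau> \<longrightarrow> \<tau> \<notin> S))"
  proof cases
    case 1
    then show ?thesis using met_sound S by blast
  next
    case 2
    have "initial_segment (map G [0..<p]) G" by (simp add: initial_segment_def)
    moreover have "\<tau> \<notin> S" if "prefix (map G [0..<p]) \<tau>" for \<tau>
      using met_complete[OF _ that] 2 S by blast
    ultimately show ?thesis by blast
  qed
qed

section \<open>Domination for almost every oracle\<close>

lemma ex_success_card:
  "n < card (successes X p) \<Longrightarrow> \<exists>q<p. q \<in> successes X (Suc q) \<and> card (successes X q) = n"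
proof (induction p)
  case (Suc p)
  show ?case
  proof (cases "n < card (successes X p)")
    case True
    then show ?thesis using Suc.IH less_SucI by blast
  next
    case False
    have p: "p \<notin> successes X p" by (auto dest: successes_less)
    with False Suc.prems have "p \<in> successes X (Suc p)" "card (successes X p) = n"
      by (auto simp: successes.simps(2) split: if_splits)
    then show ?thesis by blast
  qed
qed simp

text \<open>All quantifiers range over numbers, so measurability is a matter of countable
  operations. Oracles at which the functional is partial belong to the class by default.\<close>

definition dominated_class :: "(nat \<Rightarrow> nat) \<Rightarrow> nat \<Rightarrow> (nat \<Rightarrow> bool) set" where
  "dominated_class f e = {Z. (\<forall>m. \<exists>s. converges e m s Z) \<longrightarrow>
     (\<exists>n0. \<forall>n. n0 \<le> n \<longrightarrow> (\<exists>y. \<exists>s. y \<le> f n \<and> ev e (lcons n 0) y \<in> stage Z s))}"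

lemma dominated_class_measurable: "dominated_class f e \<in> sets fair_coin_measure"
proof -
  have "local_below s {Z. ev e (lcons n 0) y \<in> stage Z s}" for n y s
    unfolding local_below_def using stage_local by blast
  then have "{Z. ev e (lcons n 0) y \<in> stage Z s} \<in> sets fair_coin_measure" for n y s
    by (rule local_below_measure(1))
  then have "{Z. y \<le> f n \<and> ev e (lcons n 0) y \<in> stage Z s} \<in> sets fair_coin_measure" for n y s
    by (cases "y \<le> f n") simp_all
  then show ?thesis
    unfolding dominated_class_def
    by (intro Collect_imp_measurable Collect_all_measurable Collect_ex_measurable
        converges_measurable Collect_const_measurable)
qed

lemma converges_iff:
  "(\<exists>s. converges (recfun_encode d) n s Z) \<longleftrightarrow> (\<exists>y. evaluates (char_fun Z) d [n] y)"
proof -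
  have "(\<exists>s. converges e n s Z) \<longleftrightarrow> (\<exists>y s. ev e (lcons n 0) y \<in> stage Z s)" for e
    unfolding converges_def by (meson ev_le(2) le_less_trans stage_less)
  then show ?thesis using evaluates_iff_stage[of Z d "[n]"] by simp
qed

lemma dominated_class_iff:
  "Z \<in> dominated_class f (recfun_encode d) \<longleftrightarrow> ((\<forall>n. \<exists>y. evaluates (char_fun Z) d [n] y) \<longrightarrow>
    (\<exists>n0. \<forall>n\<ge>n0. \<exists>y\<le>f n. evaluates (char_fun Z) d [n] y))"
proof -
  have e: "(\<exists>s. ev (recfun_encode d) (lcons n 0) y \<in> stage Z s) \<longleftrightarrow> evaluates (char_fun Z) d [n] y" for n y
    using evaluates_iff_stage[of Z d "[n]" y] by simp
  show ?thesis
    unfolding dominated_class_def mem_Collect_eq converges_iff by (simp only: ex_simps e)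
qed

text \<open>A description determines the function it computes, so the quantifier over functions
  becomes a countable intersection.\<close>

lemma dominated_classes:
  "{Z. \<forall>g. g \<le>\<^sub>T Z \<longrightarrow> g \<le>\<^sup>* f} = (\<Inter>d. dominated_class f (recfun_encode d))"
proof (intro set_eqI iffI)
  fix Z assume Z: "Z \<in> {Z. \<forall>g. g \<le>\<^sub>T Z \<longrightarrow> g \<le>\<^sup>* f}"
  have "Z \<in> dominated_class f (recfun_encode d)" for d
    unfolding dominated_class_iff
  proof
    assume "\<forall>n. \<exists>y. evaluates (char_fun Z) d [n] y"
    then obtain g where g: "\<And>n. evaluates (char_fun Z) d [n] (g n)" by metis
    then have "g \<le>\<^sup>* f" using Z unfolding turing_reducible_def by blast
    then show "\<exists>n0. \<forall>n\<ge>n0. \<exists>y\<le>f n. evaluates (char_fun Z) d [n] y"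
      unfolding dominated_by_def using g by blast
  qed
  then show "Z \<in> (\<Inter>d. dominated_class f (recfun_encode d))" by blast
next
  fix Z assume Z: "Z \<in> (\<Inter>d. dominated_class f (recfun_encode d))"
  have "g \<le>\<^sup>* f" if g: "g \<le>\<^sub>T Z" for g
  proof -
    obtain d where d: "\<And>n. evaluates (char_fun Z) d [n] (g n)"
      using g unfolding turing_reducible_def by blast
    have "Z \<in> dominated_class f (recfun_encode d)" using Z by blast
    then obtain n0 where "\<And>n. n0 \<le> n \<Longrightarrow> \<exists>y\<le>f n. evaluates (char_fun Z) d [n] y"
      unfolding dominated_class_iff using d by blast
    then have "g n \<le> f n" if "n0 \<le> n" for n
      using that evaluates_deterministic[OF d[of n]] by metis
    then show ?thesis unfolding dominated_by_def by blast
  qed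
  then show "Z \<in> {Z. \<forall>g. g \<le>\<^sub>T Z \<longrightarrow> g \<le>\<^sup>* f}" by blast
qed

text \<open>Domination can fail only where the functional is total, so the exceptional class lies in
  \<open>total e - P\<close> and has measure at most \<epsilon>.\<close>

lemma uniformly_ae_dominatingI:
  assumes "\<And>e \<epsilon>. 0 < \<epsilon> \<Longrightarrow> \<exists>P\<in>sets fair_coin_measure.
    P \<subseteq> total e \<inter> dominated_class f e \<and> \<mu> (total e) - \<epsilon> \<le> \<mu> P"
  shows "uniformly_ae_dominating f"
proof -
  have null: "\<mu> (UNIV - dominated_class f e) = 0" for e
  proof (rule antisym)
    show "\<mu> (UNIV - dominated_class f e) \<le> 0"
    proof (rule field_le_epsilon)
      fix \<epsilon> :: real assume "0 < \<epsilon>"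
      then obtain P where P: "P \<in> sets fair_coin_measure" "P \<subseteq> total e \<inter> dominated_class f e"
        "\<mu> (total e) - \<epsilon> \<le> \<mu> P" using assms by blast
      have "UNIV - dominated_class f e \<subseteq> total e - P"
        using P(2) unfolding dominated_class_def total_def by auto
      then have "\<mu> (UNIV - dominated_class f e) \<le> \<mu> (total e - P)"
        by (intro coin.finite_measure_mono sets.Diff total_measurable P(1))
      also have "\<dots> = \<mu> (total e) - \<mu> P"
        using P(2) by (intro coin.finite_measure_Diff total_measurable P(1)) auto
      finally show "\<mu> (UNIV - dominated_class f e) \<le> 0 + \<epsilon>" using P(3) by simp
    qed
  qed simp
  have "AE Z in fair_coin_measure. Z \<in> dominated_class f e" for e
  proof (rule AE_I)
    show "emeasure fair_coin_measure (UNIV - dominated_class f e) = 0"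
      using null by (simp add: coin.emeasure_eq_measure)
    show "UNIV - dominated_class f e \<in> sets fair_coin_measure"
      using sets.compl_sets[OF dominated_class_measurable] by simp
  qed auto
  then have "AE Z in fair_coin_measure. \<forall>e. Z \<in> dominated_class f e"
    by (simp add: AE_all_countable)
  then have "AE Z in fair_coin_measure. Z \<in> {Z. \<forall>g. g \<le>\<^sub>T Z \<longrightarrow> g \<le>\<^sup>* f}"
    unfolding dominated_classes by (rule AE_mp) simp
  moreover have "{Z. \<forall>g. g \<le>\<^sub>T Z \<longrightarrow> g \<le>\<^sup>* f} \<in> sets fair_coin_measure"
  proof -
    have "{Z. \<forall>g. g \<le>\<^sub>T Z \<longrightarrow> g \<le>\<^sup>* f} = (\<Inter>e\<in>range recfun_encode. dominated_class f e)"
      unfolding dominated_classes by simp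
    then show ?thesis
      by (simp only:) (intro sets.countable_INT' dominated_class_measurable, auto simp: dominated_class_measurable)
  qed
  ultimately show ?thesis
    unfolding uniformly_ae_dominating_def using coin.emeasure_eq_1_AE by blast
qed

text \<open>Values of index at least \<open>card (successes G h)\<close> are accepted at positions
  from h on, so members of the class converge by stage \<open>value_of G n\<close>, with an output
  below it. Smaller arguments are covered since each value demands convergence on all arguments up
  to its index.\<close>

lemma req_class_dominated:
  assumes card: "\<And>n. \<exists>p. n \<le> card (successes G p)"
  shows "(\<Inter>p. req_class G p h) \<subseteq> total (req_fun h) \<inter> dominated_class (value_of G) (req_fun h)"
proof
  fix Z assume Z: "Z \<in> (\<Inter>p. req_class G p h)"
  have conv: "converges (req_fun h) m (value_of G n) Z" if n: "card (successes G h) \<le> n" and m: "m \<le> n" for n m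
  proof -
    obtain p where "Suc n \<le> card (successes G p)" using card by blast
    then have "\<exists>q. q \<in> successes G (Suc q) \<and> card (successes G q) = n"
      using ex_success_card[of n G p] by auto
    then have q: "value_of G n \<in> successes G (Suc (value_of G n))" "card (successes G (value_of G n)) = n"
      unfolding value_of_def using LeastI_ex[of "\<lambda>q. q \<in> successes G (Suc q) \<and> card (successes G q) = n"]
      by auto
    let ?q = "value_of G n"
    have "h \<le> ?q"
    proof (rule ccontr)
      assume "\<not> h \<le> ?q"
      then have hq: "Suc ?q \<le> h" by simp
      have "insert ?q (successes G ?q) \<subseteq> successes G h"
        using successes_Int[OF hq, of G] successes_Int[of ?q h G] q(1) hq by auto
      then have "card (insert ?q (successes G ?q)) \<le> card (successes G h)" by (intro card_mono) auto
      moreover have "?q \<notin> successes G ?q" by (auto dest: successes_less)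
      ultimately show False using q(2) n by simp
    qed
    moreover have "Z \<in> req_class G (Suc ?q) h" using Z by blast
    moreover have "successes G (Suc ?q) \<inter> {..<?q} = successes G ?q" by (rule successes_Int) simp
    ultimately show ?thesis using q m unfolding req_class_def conv_class_def by auto
  qed
  have "\<exists>s. converges (req_fun h) m s Z" for m
    using conv[of "card (successes G h) + m" m] by auto
  then have "Z \<in> total (req_fun h)" unfolding total_def by simp
  moreover have "\<exists>y s. y \<le> value_of G n \<and> ev (req_fun h) (lcons n 0) y \<in> stage Z s"
    if "card (successes G h) \<le> n" for n
    using conv[OF that order_refl] unfolding converges_def by (meson less_imp_le)
  then have "Z \<in> dominated_class (value_of G) (req_fun h)" unfolding dominated_class_def by blast
  ultimately show "Z \<in> total (req_fun h) \<inter> dominated_class (value_of G) (req_fun h)" by blast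
qed

theorem corollary13:
  "\<exists>(G :: nat \<Rightarrow> bool) (f :: nat \<Rightarrow> nat). one_generic G \<and> uniformly_ae_dominating f \<and> f \<le>\<^sub>T G"
proof -
  obtain G where G: "\<And>l. \<exists>p. good G l p \<and> l \<le> p \<and> l \<le> Suc (card (successes G p)) \<and>
    (\<forall>i<l. served G p i)"
    using generic_exists by blast
  have "one_generic G"
  proof (rule one_genericI)
    fix l
    obtain p where "good G (Suc l) p" using G by blast
    then show "\<exists>p. decided G p l" unfolding good_def by blast
  qed
  moreover have card: "\<exists>p. n \<le> card (successes G p)" for n
    using G[of "Suc n"] by (metis Suc_le_mono)
  have "value_of G \<le>\<^sub>T G"
  proof (rule value_of_turing_reducible)
    fix n
    obtain p where "Suc n \<le> card (successes G p)" using card by blast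
    then show "\<exists>q. q \<in> successes G (Suc q) \<and> card (successes G q) = n"
      using ex_success_card[of n G p] by auto
  qed
  moreover have "uniformly_ae_dominating (value_of G)"
  proof (rule uniformly_ae_dominatingI)
    fix e and \<epsilon> :: real assume \<epsilon>: "0 < \<epsilon>"
    show "\<exists>P\<in>sets fair_coin_measure. P \<subseteq> total e \<inter> dominated_class (value_of G) e \<and> \<mu> (total e) - \<epsilon> \<le> \<mu> P"
    proof (cases "\<mu> (total e) - \<epsilon> \<le> 0")
      case True
      then show ?thesis by (intro bexI[of _ "{}"]) auto
    next
      case False
      \<comment> \<open>One half of \<epsilon> is spent on the distance from r to the measure of
        \<open>total e\<close>, the other on the budget.\<close>
      obtain r where r: "r \<in> \<rat>" "max 0 (\<mu> (total e) - \<epsilon> / 2) < r" "r < \<mu> (total e)"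
        using Rats_dense_in_real[of "max 0 (\<mu> (total e) - \<epsilon> / 2)" "\<mu> (total e)"] False \<epsilon> by auto
      obtain a b :: nat where ab: "r = real a / real (Suc b)"
      proof -
        from r have "0 \<le> r" by simp
        then obtain m n :: nat where "n \<noteq> 0" "\<bar>r\<bar> = real m / real n"
          using Rats_abs_nat_div_natE[OF r(1)] by metis
        then show ?thesis using that[of m "n - 1"] \<open>0 \<le> r\<close> by simp
      qed
      obtain k where k: "(1/2::real) ^ k < \<epsilon> / 2"
        using real_arch_pow_inv[of "\<epsilon> / 2" "1/2"] \<epsilon> by auto
      \<comment> \<open>The padding k makes the level j at least k, so the budget stays below
        \<epsilon>/2.\<close>
      define j where "j = pair e (pair a (pair b k))"
      have "k \<le> j" unfolding j_def by (meson le_prod_encode_2 order_trans)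
      have j: "requirement_at j e a b" unfolding requirement_at_def j_def by blast
      have req: "\<exists>p h. l \<le> p \<and> good G l p \<and> active G p h \<and> level h = j \<and> req_fun h = e \<and> threshold h = r"
        if "j < l" for l
        using G[of l] that j r(3) unfolding ab served_def by blast
      obtain p0 h where h: "good G (Suc j) p0" "active G p0 h" "level h = j" "req_fun h = e" "threshold h = r"
        using req[OF lessI] by blast
      have large: "r - 1 / 2 ^ j \<le> \<mu> (req_class G p h)" for p
      proof -
        \<comment> \<open>The position q lies beyond \<open>p0\<close>, from which h stays active,
          and beyond p, so that its class is contained in the one at p.\<close>
        obtain q where q: "good G (Suc j + p + p0) q" "Suc j + p + p0 \<le> q" using G by blast
        have "active G q h" using active_extend[OF h(1) agree_refl _ h(2)] q(2) by simp
        then have "fulfilled G q h" using q(1) by (simp add: good_def)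
        then have "r < \<mu> (req_class G q h \<inter> total e) + budget G q h" unfolding fulfilled_def h .
        also have "\<mu> (req_class G q h \<inter> total e) \<le> \<mu> (req_class G p h)"
          using req_class_antimono[of p q G h] q(2) by (intro coin.finite_measure_mono req_class_measurable) auto
        finally show ?thesis using budget_le[of G q h] unfolding h by simp
      qed
      have "(\<lambda>p. \<mu> (req_class G p h)) \<longlonglongrightarrow> \<mu> (\<Inter>p. req_class G p h)"
        by (rule coin.finite_Lim_measure_decseq) (auto simp: decseq_def dest: req_class_antimono)
      then have "r - 1 / 2 ^ j \<le> \<mu> (\<Inter>p. req_class G p h)"
        by (rule LIMSEQ_le_const) (use large in blast)
      moreover have "1 / 2 ^ j \<le> (1/2::real) ^ k"
        using \<open>k \<le> j\<close> by (simp add: power_one_over field_simps)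
      ultimately have "\<mu> (total e) - \<epsilon> \<le> \<mu> (\<Inter>p. req_class G p h)" using k r(2) by simp
      moreover have "(\<Inter>p. req_class G p h) \<in> sets fair_coin_measure"
        by (intro sets.countable_INT) (auto simp: req_class_measurable)
      ultimately show ?thesis using req_class_dominated[OF card, of h] unfolding h by blast
    qed
  qed
  ultimately show ?thesis by blast
qed

end
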